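(* Let $R$ be a complete valuation ring which is not a field, whose field of fractions $K$ is algebraically closed, and let $F$ be the residue field of $R$. Then: (a) $\mathbb{A}_R^1$ is path connected. (b) $\mathbb{A}_R^1$ is locally path connected. (c) $\mathbb{A}_R^1$ is first countable if and only if $F$ is countable and $\mathbb{A}_K^1$ is first countable.
   Context: For a commutative unital Banach ring $(S,\|\cdot\|)$, $\mathbb{A}_S^1$ is the set of all non-zero multiplicative seminorms $\lambda$, written $\mathbf{p}\mapsto|\mathbf{p}|_\lambda$, on the polynomial ring $S[\mathbf{t}]$ whose restrictions to $S$ are contractive ($|a|_\lambda\le\|a\|$ for $a\in S$), with the topology of pointwise convergence. A valuation ring is an integral domain $R$ with field of fractions $K$ such that for every non-zero $x\in K$, $x\in R$ or $x^{-1}\in R$. It is a complete valuation ring if the totally ordered group $K^\times/R^\times$ is isomorphic to an ordered subgroup of $\mathbb{R}$ and $R$ is complete under the induced norm; equivalently, $R=\{a\in K:|a|\le1\}$ for a complete non-Archimedean valued field $(K,|\cdot|)$. Both $R$ and $K$ carry the norm $|\cdot|$. A topological space is locally path connected if every point has a neighborhood basis consisting of open sets that are path connected under the induced topology. *)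

theory Defs
  imports "HOL-Analysis.Analysis" "HOL-Computational_Algebra.Computational_Algebra"
begin

section \<open>The affine line over a normed ring\<close>

text \<open>Rings are given as subrings of an ambient type: \<open>S\<close> is the ring and \<open>N\<close> its norm.
  Applied to the unit ball of a valued field and to the whole field, this yields
  \<open>\<A>\<^sub>R\<^sup>1\<close> and \<open>\<A>\<^sub>K\<^sup>1\<close> from one definition.\<close>

definition subring_of_type :: "'a::comm_ring_1 set \<Rightarrow> bool" where
  "subring_of_type S \<longleftrightarrow> 1 \<in> S \<and> (\<forall>a\<in>S. \<forall>b\<in>S. a - b \<in> S \<and> a * b \<in> S)"

definition polys_over :: "'a::comm_ring_1 set \<Rightarrow> 'a poly set" where
  "polys_over S = {p. \<forall>i. coeff p i \<in> S}"

definition multiplicative_seminorm_on :: "'b::comm_ring_1 set \<Rightarrow> ('b \<Rightarrow> real) \<Rightarrow> bool" where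
  "multiplicative_seminorm_on A \<phi> \<longleftrightarrow>
     \<phi> 0 = 0 \<and>
     (\<forall>p\<in>A. 0 \<le> \<phi> p) \<and>
     (\<forall>p\<in>A. \<forall>q\<in>A. \<phi> (p + q) \<le> \<phi> p + \<phi> q) \<and>
     (\<forall>p\<in>A. \<forall>q\<in>A. \<phi> (p * q) = \<phi> p * \<phi> q)"

text \<open>Extensionality makes these functions on \<open>S[t]\<close> rather than on all of \<^typ>\<open>'a poly\<close>.\<close>

definition affine_line_set :: "'a::comm_ring_1 set \<Rightarrow> ('a \<Rightarrow> real) \<Rightarrow> ('a poly \<Rightarrow> real) set" where
  "affine_line_set S N =
     {\<phi> \<in> extensional (polys_over S).
        multiplicative_seminorm_on (polys_over S) \<phi> \<and>
        (\<exists>p\<in>polys_over S. \<phi> p \<noteq> 0) \<and>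
        (\<forall>a\<in>S. \<phi> [:a:] \<le> N a)}"

definition affine_line :: "'a::comm_ring_1 set \<Rightarrow> ('a \<Rightarrow> real) \<Rightarrow> ('a poly \<Rightarrow> real) topology" where
  "affine_line S N = subtopology (powertop_real (polys_over S)) (affine_line_set S N)"


section \<open>Complete valuation rings\<close>

text \<open>A valuation ring is given inside its field of fractions, which is the ambient type:
  the condition on \<open>x\<close> and \<open>inverse x\<close> makes every element of \<^typ>\<open>'k\<close> a quotient of
  elements of \<open>R\<close>.\<close>

definition valuation_ring :: "'k::field set \<Rightarrow> bool" where
  "valuation_ring R \<longleftrightarrow> subring_of_type R \<and> (\<forall>x. x \<noteq> 0 \<longrightarrow> x \<in> R \<or> inverse x \<in> R)"

text \<open>The norm \<open>N\<close> is the exponential of an isomorphism from the value group \<open>K\<^sup>\<times>/R\<^sup>\<times>\<close> onto an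
  ordered subgroup of the reals: it is multiplicative, and \<open>N x \<le> N y\<close> iff \<open>x \<in> y R\<close>
  (for \<open>y \<noteq> 0\<close>), which by multiplicativity is the assumption \<open>norm_le_1_iff\<close>.\<close>

locale complete_valuation_ring =
  fixes R :: "'k::field set" and N :: "'k \<Rightarrow> real"
  assumes valuation_ring: "valuation_ring R"
    and norm_0: "N 0 = 0"
    and norm_pos: "x \<noteq> 0 \<Longrightarrow> 0 < N x"
    and norm_mult: "N (x * y) = N x * N y"
    and norm_le_1_iff: "N x \<le> 1 \<longleftrightarrow> x \<in> R"
    and complete: "Metric_space.mcomplete R (\<lambda>x y. N (x - y))"

definition maximal_ideal :: "'k::field set \<Rightarrow> 'k set" where
  "maximal_ideal R = {a\<in>R. \<not> (\<exists>b\<in>R. a * b = 1)}"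

definition residue_field :: "'k::field set \<Rightarrow> 'k set set" where
  "residue_field R = R // {(a, b). a \<in> R \<and> b \<in> R \<and> a - b \<in> maximal_ideal R}"

definition is_subfield :: "'k::field set \<Rightarrow> bool" where
  "is_subfield R \<longleftrightarrow> subring_of_type R \<and> (\<forall>a\<in>R. a \<noteq> 0 \<longrightarrow> (\<exists>b\<in>R. a * b = 1))"


subsection \<open>Unit balls of complete non-Archimedean valued fields\<close>

definition nonarch_norm :: "('k::field \<Rightarrow> real) \<Rightarrow> bool" where
  "nonarch_norm N \<longleftrightarrow>
     N 0 = 0 \<and> (\<forall>x. x \<noteq> 0 \<longrightarrow> 0 < N x) \<and> (\<forall>x y. N (x * y) = N x * N y) \<and>
     (\<forall>x y. N (x + y) \<le> max (N x) (N y))"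

lemma nonarch_norm_1: "nonarch_norm N \<Longrightarrow> N 1 = 1"
  unfolding nonarch_norm_def
  by (metis less_numeral_extra(3) mult_cancel_left1 mult_1 zero_neq_one)

lemma nonarch_norm_minus:
  assumes "nonarch_norm N" shows "N (- x) = N x"
proof -
  have "N (-1) * N (-1) = 1"
    using assms nonarch_norm_1[OF assms] unfolding nonarch_norm_def
    by (metis mult_minus1 add.inverse_inverse)
  moreover have "0 < N (-1)"
    using assms unfolding nonarch_norm_def by simp
  ultimately have "N (-1) = 1"
    by (metis abs_of_pos power2_eq_square power2_eq_1_iff less_numeral_extra(1) not_less_iff_gr_or_eq
        neg_less_0_iff_less)
  then show ?thesis
    using assms unfolding nonarch_norm_def by (metis mult_minus1 mult_1)
qed

lemma nonarch_norm_Metric_space: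
  assumes "nonarch_norm N" shows "Metric_space A (\<lambda>x y. N (x - y))"
proof
  fix x y z
  show "0 \<le> N (x - y)"
    using assms unfolding nonarch_norm_def by (metis order.refl less_imp_le)
  show "N (x - y) = N (y - x)"
    using nonarch_norm_minus[OF assms, of "x - y"] by simp
  show "N (x - y) = 0 \<longleftrightarrow> x = y"
    using assms unfolding nonarch_norm_def by (metis eq_iff_diff_eq_0 less_irrefl)
  have "N (x - z) \<le> max (N (x - y)) (N (y - z))"
    using assms unfolding nonarch_norm_def by (metis diff_add_cancel add_diff_eq)
  moreover have "0 \<le> N a" for a
    using assms unfolding nonarch_norm_def by (metis order.refl less_imp_le)
  ultimately show "N (x - z) \<le> N (x - y) + N (y - z)"
    by (smt (verit))
qed

lemma (in complete_valuation_ring) nonarch: "nonarch_norm N"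
proof -
  have sub: "1 \<in> R" "\<And>a b. a \<in> R \<Longrightarrow> b \<in> R \<Longrightarrow> a - b \<in> R"
    using valuation_ring by (auto simp: valuation_ring_def subring_of_type_def)
  have add: "a + b \<in> R" if "a \<in> R" "b \<in> R" for a b
    using sub(2)[OF that(1) sub(2)[OF sub(2)[OF that(2) that(2)] that(2)]] by simp
  have ge0: "0 \<le> N x" for x
    using norm_0 norm_pos[of x] by (cases "x = 0") auto
  have *: "N (x + y) \<le> N y" if "N x \<le> N y" for x y
  proof (cases "y = 0")
    case True
    with that norm_0 norm_pos[of x] show ?thesis by (cases "x = 0") auto
  next
    case False
    have x: "N x = N (x / y) * N y" and xy: "N (x + y) = N (x / y + 1) * N y"
      using False norm_mult[of "x / y" y] norm_mult[of "x / y + 1" y] by (simp_all add: distrib_right)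
    have "N (x / y) \<le> 1"
      using that x norm_pos[OF False] by simp
    then have "N (x / y + 1) \<le> 1"
      using add sub(1) by (simp add: norm_le_1_iff)
    then show ?thesis
      using xy mult_right_mono[of _ 1 "N y"] ge0[of y] by simp
  qed
  have "N (x + y) \<le> max (N x) (N y)" for x y
    using *[of x y] *[of y x] by (cases "N x \<le> N y") (auto simp: add.commute)
  then show ?thesis
    using norm_0 norm_pos norm_mult by (simp add: nonarch_norm_def)
qed

lemma nonarch_unit_ball_complete_iff:
  fixes N :: "'k::field \<Rightarrow> real"
  assumes N: "nonarch_norm N"
  shows "Metric_space.mcomplete {x. N x \<le> 1} (\<lambda>x y. N (x - y)) \<longleftrightarrow>
         Metric_space.mcomplete UNIV (\<lambda>x y. N (x - y))"
proof -
  interpret K: Metric_space UNIV "\<lambda>x y. N (x - y)" by (rule nonarch_norm_Metric_space[OF N])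
  interpret B: Metric_space "{x. N x \<le> 1}" "\<lambda>x y. N (x - y)"
    by (rule nonarch_norm_Metric_space[OF N])
  have ultra: "N (x + y) \<le> max (N x) (N y)" for x y
    using N by (simp add: nonarch_norm_def)
  show ?thesis
  proof
    assume c: "B.mcomplete"
    show "K.mcomplete"
      unfolding K.mcomplete_def
    proof (intro allI impI)
      fix \<sigma> assume s: "K.MCauchy \<sigma>"
      then obtain m where m: "\<And>n n'. m \<le> n \<Longrightarrow> m \<le> n' \<Longrightarrow> N (\<sigma> n - \<sigma> n') < 1"
        unfolding K.MCauchy_def by (meson zero_less_one)
      define \<tau> where "\<tau> n = \<sigma> (n + m) - \<sigma> m" for n
      have "B.MCauchy \<tau>"
        unfolding B.MCauchy_def
      proof (intro conjI allI impI)
        show "range \<tau> \<subseteq> {x. N x \<le> 1}"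
          using m[of _ m] by (force simp: \<tau>_def intro: less_imp_le)
        fix e :: real assume "0 < e"
        then obtain k where k: "\<And>n n'. k \<le> n \<Longrightarrow> k \<le> n' \<Longrightarrow> N (\<sigma> n - \<sigma> n') < e"
          using s unfolding K.MCauchy_def by meson
        show "\<exists>k. \<forall>n n'. k \<le> n \<longrightarrow> k \<le> n' \<longrightarrow> N (\<tau> n - \<tau> n') < e"
          by (rule exI[of _ k]) (simp add: \<tau>_def k)
      qed
      with c obtain l where l: "limitin B.mtopology \<tau> l sequentially"
        unfolding B.mcomplete_def by blast
      have "limitin K.mtopology \<sigma> (l + \<sigma> m) sequentially"
        unfolding K.limit_metric_sequentially
      proof (intro conjI allI impI)
        fix e :: real assume "0 < e"
        then obtain k where k: "\<And>n. k \<le> n \<Longrightarrow> N (\<tau> n - l) < e"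
          using l unfolding B.limit_metric_sequentially by blast
        have "N (\<sigma> n - (l + \<sigma> m)) < e" if "k + m \<le> n" for n
          using k[of "n - m"] that by (simp add: \<tau>_def algebra_simps)
        then show "\<exists>k. \<forall>n\<ge>k. \<sigma> n \<in> UNIV \<and> N (\<sigma> n - (l + \<sigma> m)) < e"
          by blast
      qed simp
      then show "\<exists>x. limitin K.mtopology \<sigma> x sequentially" ..
    qed
  next
    assume c: "K.mcomplete"
    show "B.mcomplete"
      unfolding B.mcomplete_def
    proof (intro allI impI)
      fix \<sigma> assume s: "B.MCauchy \<sigma>"
      then have "K.MCauchy \<sigma>"
        unfolding B.MCauchy_def K.MCauchy_def by simp
      with c obtain l where l: "limitin K.mtopology \<sigma> l sequentially"
        unfolding K.mcomplete_def by blast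
      have r: "N (\<sigma> n) \<le> 1" for n
        using s unfolding B.MCauchy_def by blast
      obtain k where "N (\<sigma> k - l) < 1"
        using l unfolding K.limit_metric_sequentially by (meson order.refl zero_less_one)
      then have "N l \<le> 1"
        using ultra[of "l - \<sigma> k" "\<sigma> k"] r[of k] nonarch_norm_minus[OF N, of "l - \<sigma> k"] by simp
      then have "limitin B.mtopology \<sigma> l sequentially"
        using l r unfolding B.limit_metric_sequentially K.limit_metric_sequentially by simp
      then show "\<exists>x. limitin B.mtopology \<sigma> x sequentially" ..
    qed
  qed
qed

theorem complete_valuation_ring_iff:
  "complete_valuation_ring R N \<longleftrightarrow>
     nonarch_norm N \<and> Metric_space.mcomplete UNIV (\<lambda>x y. N (x - y)) \<and> R = {x. N x \<le> 1}"
proof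
  assume "complete_valuation_ring R N"
  then interpret complete_valuation_ring R N .
  have "R = {x. N x \<le> 1}"
    by (simp add: norm_le_1_iff)
  then show "nonarch_norm N \<and> Metric_space.mcomplete UNIV (\<lambda>x y. N (x - y)) \<and> R = {x. N x \<le> 1}"
    using nonarch complete nonarch_unit_ball_complete_iff[OF nonarch] by simp
next
  assume *: "nonarch_norm N \<and> Metric_space.mcomplete UNIV (\<lambda>x y. N (x - y)) \<and> R = {x. N x \<le> 1}"
  then have N: "nonarch_norm N" and R: "R = {x. N x \<le> 1}" by auto
  have ge0: "0 \<le> N x" for x
    using N unfolding nonarch_norm_def by (metis order.refl less_imp_le)
  have mult: "N (x * y) = N x * N y" and ultra: "N (x + y) \<le> max (N x) (N y)" for x y
    using N by (auto simp: nonarch_norm_def)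
  have "a - b \<in> R" "a * b \<in> R" if "a \<in> R" "b \<in> R" for a b
    using that ultra[of a "- b"] nonarch_norm_minus[OF N, of b] mult[of a b]
      mult_le_one[of "N a" "N b"] ge0[of b] by (auto simp: R)
  moreover have "inverse x \<in> R" if "x \<noteq> 0" "x \<notin> R" for x
  proof -
    have "N x * N (inverse x) = 1"
      using mult[of x "inverse x"] that nonarch_norm_1[OF N] by simp
    moreover have "1 < N x"
      using that by (simp add: R)
    ultimately show ?thesis
      using mult_right_mono[of 1 "N x" "N (inverse x)"] ge0[of "inverse x"] by (simp add: R)
  qed
  moreover have "1 \<in> R"
    using nonarch_norm_1[OF N] by (simp add: R)
  ultimately have "valuation_ring R"
    unfolding valuation_ring_def subring_of_type_def by blast
  then show "complete_valuation_ring R N"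
    using * nonarch_unit_ball_complete_iff[OF N]
    by unfold_locales (auto simp: nonarch_norm_def R)
qed

end

theory Submission
  imports Defs
begin

text \<open>The proof describes the line by coordinates in which neighbourhoods are boxes, and finds paths
  along which every coordinate is monotone.

  \<^bold>\<open>Fibres.\<close> A point \<open>y\<close> restricts to \<open>R\<close> as \<open>N ^ s\<close> for one \<open>s \<in> [1, \<infinity>]\<close>, where \<open>s = \<infinity>\<close> means the norm that is
  1 on units and 0 on the maximal ideal (\<open>pts_const\<close>). Fix \<open>c\<close> with \<open>0 < N c < 1\<close>; then \<open>s\<close> is encoded by
  \<open>\<sigma> = y [:c:] \<in> [0, N c]\<close>. The points with \<open>\<sigma> > 0\<close> are powers of points of the line over the field, and
  the fibre \<open>\<sigma> = 0\<close> is the line over the residue field with its trivial norm.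

  \<^bold>\<open>Coordinates.\<close> As the field is algebraically closed, Gauss's lemma shows that every polynomial over
  \<open>R\<close> is a product of polynomials \<open>a t + b\<close> with \<open>a\<close> and \<open>b\<close> in \<open>R\<close> (\<open>linear_factor\<close>). So the values at
  these determine the points and the topology.

  \<^bold>\<open>Paths.\<close> Three operations move points: thickening \<open>y\<close> by a radius \<open>r\<close>, with coordinates
  \<open>max (y [:b, a:]) (y [:a:] * r)\<close>; taking powers, which changes \<open>\<sigma> > 0\<close>; and changing \<open>\<sigma>\<close>, possibly to 0,
  for the Gauss point of a disc. All coordinates are monotone along the resulting paths, so a path
  stays in every box that contains its ends (\<open>path_in_nbhd\<close>).

  \<^bold>\<open>Path connectedness.\<close> Thickening turns each point into a disc around 0, and discs around 0 are
  connected with the point \<open>t = 0\<close> of the residue fibre.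

  \<^bold>\<open>Local path connectedness.\<close> If \<open>\<sigma> > 0\<close> at \<open>x\<close>, a nearby point is moved by a power into the fibre of \<open>x\<close>.
  Two points of one fibre have a join, whose coordinates are the maxima of theirs (\<open>fibre_join\<close>), and
  the way over the join does not leave a box. If \<open>\<sigma> = 0\<close>, then \<open>x\<close> is a disc around some \<open>a\<close>
  (\<open>residue_point_is_disc\<close>); a nearby point is thickened to a disc around \<open>a\<close>, moved to \<open>\<sigma> = 0\<close>, and its
  radius is adjusted.

  \<^bold>\<open>First countability.\<close> The line over the field embeds in the line over \<open>R\<close>, and locally the part \<open>\<sigma> > 0\<close> is
  its product with an interval, so there the two lines have the same local bases. At \<open>\<sigma> = 0\<close> the values
  at \<open>c\<close> and at \<open>t - d\<close>, for representatives \<open>d\<close> of the residue classes, control a neighbourhood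
  (\<open>countable_base_residue\<close>). Conversely a neighbourhood of the Gauss point of the residue fibre
  contains the classical points of all but finitely many residue classes, so a countable
  base there makes the residue field countable (\<open>countable_residue_field\<close>).\<close>

section \<open>Non-Archimedean multiplicative seminorms\<close>

lemma subring_closed:
  assumes "subring_of_type A"
  shows "0 \<in> A" "1 \<in> A" "a \<in> A \<Longrightarrow> - a \<in> A" "a \<in> A \<Longrightarrow> b \<in> A \<Longrightarrow> a + b \<in> A"
    "a \<in> A \<Longrightarrow> b \<in> A \<Longrightarrow> a - b \<in> A" "a \<in> A \<Longrightarrow> b \<in> A \<Longrightarrow> a * b \<in> A"
proof -
  have d: "\<And>a b. a \<in> A \<Longrightarrow> b \<in> A \<Longrightarrow> a - b \<in> A" and "1 \<in> A"
    using assms by (auto simp: subring_of_type_def)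
  then have z: "0 \<in> A" by (metis diff_self)
  with d have m: "\<And>a. a \<in> A \<Longrightarrow> - a \<in> A" by (metis diff_0)
  show "a \<in> A \<Longrightarrow> b \<in> A \<Longrightarrow> a + b \<in> A"
    using d[OF _ m, of a b] by simp
  show "0 \<in> A" "a \<in> A \<Longrightarrow> - a \<in> A" by (auto intro: z m)
qed (use assms in \<open>auto simp: subring_of_type_def\<close>)

lemma subring_sum:
  assumes "subring_of_type A" "\<And>i. i \<in> I \<Longrightarrow> f i \<in> A"
  shows "sum f I \<in> A"
  using assms(2) by (induction I rule: infinite_finite_induct) (auto simp: subring_closed[OF assms(1)])

lemma subring_power:
  assumes "subring_of_type A" "a \<in> A" shows "a ^ n \<in> A"
  by (induction n) (auto simp: subring_closed[OF assms(1)] assms(2))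

lemma subring_UNIV: "subring_of_type UNIV"
  by (simp add: subring_of_type_def)

lemma subring_polys_over:
  assumes "subring_of_type A" shows "subring_of_type (polys_over A)"
  unfolding subring_of_type_def polys_over_def
  by (auto simp: coeff_mult coeff_1 subring_closed[OF assms] intro!: subring_sum[OF assms])

text \<open>The seminorms are only required to behave on the subring \<open>A\<close>: the points of the line are
  functions on \<open>R[t]\<close>, whose ambient type is the polynomial ring over the whole field.\<close>
locale nonarch_seminorm =
  fixes A :: "'b::comm_ring_1 set" and \<phi> :: "'b \<Rightarrow> real"
  assumes subring: "subring_of_type A"
    and zero: "\<phi> 0 = 0"
    and one: "\<phi> 1 = 1"
    and nonneg: "p \<in> A \<Longrightarrow> 0 \<le> \<phi> p"
    and mult: "p \<in> A \<Longrightarrow> q \<in> A \<Longrightarrow> \<phi> (p * q) = \<phi> p * \<phi> q"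
    and ultra: "p \<in> A \<Longrightarrow> q \<in> A \<Longrightarrow> \<phi> (p + q) \<le> max (\<phi> p) (\<phi> q)"

context nonarch_seminorm
begin

lemmas closed = subring_closed[OF subring] subring_sum[OF subring]

lemma uminus: assumes "p \<in> A" shows "\<phi> (- p) = \<phi> p"
proof -
  have "\<phi> (-1) * \<phi> (-1) = 1"
    using mult[of "-1" "-1"] closed by (simp add: one)
  then have "\<phi> (-1) = 1"
    using nonneg[of "-1"] closed by (auto simp: square_eq_1_iff)
  then show ?thesis using mult[of "-1" p] assms closed by simp
qed

lemma diff: assumes "p \<in> A" "q \<in> A" shows "\<phi> (p - q) \<le> max (\<phi> p) (\<phi> q)"
  using ultra[of p "- q"] uminus[of q] assms closed by simp

text \<open>The isosceles triangle principle: \<open>p = (p + q) - q\<close>, so \<open>\<phi> p\<close> cannot exceed both \<open>\<phi> (p + q)\<close>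
  and \<open>\<phi> q\<close>.\<close>
lemma dominant:
  assumes "p \<in> A" "q \<in> A" "\<phi> q < \<phi> p" shows "\<phi> (p + q) = \<phi> p"
  using ultra[of p q] diff[of "p + q" q] assms closed by simp

lemma add_eq_max:
  assumes "p \<in> A" "q \<in> A" "\<phi> p \<noteq> \<phi> q" shows "\<phi> (p + q) = max (\<phi> p) (\<phi> q)"
  using dominant[OF assms(1,2)] dominant[OF assms(2,1)] assms(3)
  by (cases "\<phi> p < \<phi> q") (auto simp: add.commute)

text \<open>Up to elements of size \<open>\<phi> p\<close>, the elements \<open>p + q\<close> and \<open>q\<close> are the same. This is used with \<open>q\<close> a
  constant and \<open>p\<close> a multiple of \<open>t - a\<close>, to recognise discs around \<open>a\<close>.\<close>
lemma max_add_left: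
  assumes "p \<in> A" "q \<in> A" shows "max (\<phi> (p + q)) (\<phi> p) = max (\<phi> p) (\<phi> q)"
proof (cases "\<phi> p < \<phi> q")
  case True
  then have "\<phi> (p + q) = \<phi> q" using dominant[OF assms(2,1)] by (simp add: add.commute)
  then show ?thesis by (simp add: max.commute)
next
  case False
  then show ?thesis using ultra[OF assms] by simp
qed

lemma sum_less:
  assumes "\<And>i. i \<in> I \<Longrightarrow> f i \<in> A" "\<And>i. i \<in> I \<Longrightarrow> \<phi> (f i) < M" "0 < M"
  shows "\<phi> (sum f I) < M"
  using assms(1,2)
proof (induction I rule: infinite_finite_induct)
  case (insert i I)
  then show ?case using ultra[of "f i" "sum f I"] closed(7)[of I f] by force
qed (auto simp: zero assms)

lemma sum_le:
  assumes "\<And>i. i \<in> I \<Longrightarrow> f i \<in> A" "\<And>i. i \<in> I \<Longrightarrow> \<phi> (f i) \<le> M" "0 \<le> M"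
  shows "\<phi> (sum f I) \<le> M"
  using assms(1,2)
proof (induction I rule: infinite_finite_induct)
  case (insert i I)
  then show ?case using ultra[of "f i" "sum f I"] closed(7)[of I f] by force
qed (auto simp: zero assms)

lemma comp_hom:
  assumes "subring_of_type B" "\<And>p. p \<in> B \<Longrightarrow> h p \<in> A" "h 1 = 1"
    "\<And>p q. h (p + q) = h p + h q" "\<And>p q. h (p * q) = h p * h q"
  shows "nonarch_seminorm B (\<lambda>p. \<phi> (h p))"
proof -
  have "h 0 = 0" using assms(4)[of 0 0] by simp
  then show ?thesis
    by unfold_locales (auto simp: assms zero one nonneg mult ultra)
qed

end

lemma power_seminorm:
  assumes "nonarch_seminorm A \<phi>" "0 < k" shows "nonarch_seminorm A (\<lambda>p. \<phi> p powr k)"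
proof -
  interpret nonarch_seminorm A \<phi> by fact
  show ?thesis
  proof
    fix p q assume pq: "p \<in> A" "q \<in> A"
    have "\<phi> (p + q) powr k \<le> max (\<phi> p) (\<phi> q) powr k"
      using ultra[OF pq] assms(2) nonneg closed pq by (intro powr_mono2) auto
    then show "\<phi> (p + q) powr k \<le> max (\<phi> p powr k) (\<phi> q powr k)" by (auto simp: max_def split: if_splits)
    show "\<phi> (p * q) powr k = \<phi> p powr k * \<phi> q powr k" using nonneg pq by (simp add: mult powr_mult)
  qed (auto simp: subring zero one)
qed

text \<open>If \<open>x = 1 + h\<close> with \<open>h > 0\<close>, then \<open>x\<^sup>2\<^sup>n \<ge> (1 + n h)\<^sup>2\<close> by Bernoulli, which grows
  quadratically.\<close>
lemma le_1_if_powers_linear: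
  fixes x :: real
  assumes "0 \<le> x" "\<And>n. x ^ n \<le> real n + 1" shows "x \<le> 1"
proof (rule ccontr)
  assume "\<not> x \<le> 1"
  then obtain h where h: "0 < h" "x = 1 + h" by (metis add.commute diff_add_cancel diff_gt_0_iff_gt not_le)
  \<comment> \<open>\<open>(1 + n h)\<^sup>2 \<le> 2 n + 1\<close> forces \<open>n h\<^sup>2 \<le> 2\<close>.\<close>
  obtain n :: nat where n: "real n > 2 / h\<^sup>2" using reals_Archimedean2 by blast
  then have n0: "0 < n" using h by (smt (verit) divide_pos_pos of_nat_0_less_iff zero_less_power)
  have "(1 + real n * h) ^ 2 \<le> ((1 + h) ^ n) ^ 2"
    using Bernoulli_inequality[of h n] h by (intro power_mono) auto
  also have "\<dots> \<le> real (2 * n) + 1"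
    using assms(2)[of "2 * n"] h by (simp add: power_mult[symmetric] mult.commute)
  finally have "real n * (real n * h\<^sup>2) \<le> real n * 2"
    using h by (simp add: power2_eq_square algebra_simps) (smt (verit) mult_nonneg_nonneg of_nat_0_le_iff)
  then have "real n * h\<^sup>2 \<le> 2" using n0 by simp
  then show False using n h by (simp add: field_simps)
qed

text \<open>Expand \<open>(p + q)\<^sup>n\<close> binomially. The binomial coefficients have seminorm at most 1, so
  \<open>\<phi> (p + q)\<^sup>n \<le> (n + 1) M\<^sup>n\<close> with \<open>M = max (\<phi> p) (\<phi> q)\<close>, and the factor \<open>n + 1\<close> disappears in the
  limit of \<open>n\<close>-th roots.\<close>
lemma multiplicative_seminorm_imp_nonarch:
  assumes A: "subring_of_type A" and \<phi>: "multiplicative_seminorm_on A \<phi>"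
    and nz: "p \<in> A" "\<phi> p \<noteq> 0" and int: "\<And>n. \<phi> (of_nat n) \<le> 1"
  shows "nonarch_seminorm A \<phi>"
proof
  note cl = subring_closed[OF A]
  show zero: "\<phi> 0 = 0" using \<phi> by (simp add: multiplicative_seminorm_on_def)
  have nonneg: "0 \<le> \<phi> p" if "p \<in> A" for p
    using \<phi> that by (simp add: multiplicative_seminorm_on_def)
  have mult: "\<phi> (p * q) = \<phi> p * \<phi> q" and add: "\<phi> (p + q) \<le> \<phi> p + \<phi> q"
    if "p \<in> A" "q \<in> A" for p q
    using \<phi> that by (simp_all add: multiplicative_seminorm_on_def)
  show one: "\<phi> 1 = 1" using mult[OF nz(1) cl(2)] nz by simp
  have nat: "of_nat n \<in> A" for n by (induction n) (auto intro: cl)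
  have pow: "\<phi> (p ^ n) = \<phi> p ^ n" if "p \<in> A" for p n
    by (induction n) (simp_all add: one mult subring_power[OF A] that)
  have sum: "\<phi> (sum f I) \<le> (\<Sum>i\<in>I. \<phi> (f i))" if "\<And>i. i \<in> I \<Longrightarrow> f i \<in> A" for f :: "nat \<Rightarrow> _" and I
    using that
  proof (induction I rule: infinite_finite_induct)
    case (insert i I)
    then show ?case using add[of "f i" "sum f I"] subring_sum[OF A, of I f] by force
  qed (simp_all add: zero)
  fix p q assume p: "p \<in> A" and q: "q \<in> A"
  show "0 \<le> \<phi> p" "\<phi> (p * q) = \<phi> p * \<phi> q" using nonneg mult p q by auto
  let ?M = "max (\<phi> p) (\<phi> q)"
  have M: "0 \<le> ?M" using nonneg[OF p] by simp
  show "\<phi> (p + q) \<le> ?M"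
  proof (cases "?M = 0")
    case True
    then show ?thesis using add[OF p q] nonneg p q by (smt (verit))
  next
    case False
    with M have M: "0 < ?M" by simp
    have "\<phi> (p + q) / ?M \<le> 1"
    proof (rule le_1_if_powers_linear)
      show "0 \<le> \<phi> (p + q) / ?M" using M nonneg cl p q by simp
      fix n
      have "\<phi> (p + q) ^ n = \<phi> (\<Sum>k\<le>n. of_nat (n choose k) * p ^ k * q ^ (n - k))"
        using pow[of "p + q" n] cl p q by (simp add: binomial_ring)
      also have "\<dots> \<le> (\<Sum>k\<le>n. \<phi> (of_nat (n choose k) * p ^ k * q ^ (n - k)))"
        by (rule sum) (auto intro!: cl nat subring_power[OF A] p q)
      also have "\<dots> \<le> (\<Sum>k\<le>n. ?M ^ n)"
      proof (rule sum_mono)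
        fix k assume "k \<in> {..n}"
        then have k: "k + (n - k) = n" by simp
        have "\<phi> (of_nat (n choose k) * p ^ k * q ^ (n - k)) =
            \<phi> (of_nat (n choose k)) * (\<phi> p ^ k * \<phi> q ^ (n - k))"
          by (simp add: mult pow cl nat subring_power[OF A] p q)
        also have "\<dots> \<le> 1 * (?M ^ k * ?M ^ (n - k))"
          by (intro mult_mono int power_mono) (auto simp: nonneg p q le_max_iff_disj)
        also have "\<dots> = ?M ^ n" by (simp add: k flip: power_add)
        finally show "\<phi> (of_nat (n choose k) * p ^ k * q ^ (n - k)) \<le> ?M ^ n" .
      qed
      finally show "(\<phi> (p + q) / ?M) ^ n \<le> real n + 1"
        using M by (simp add: power_divide divide_simps algebra_simps)
    qed
    then show ?thesis using M by simp
  qed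
qed (rule A)

text \<open>The natural numbers have norm at most 1, which turns the triangle inequality into the
  ultrametric one. This applies to the unit ball and to the whole field alike.\<close>
lemma affine_line_set_nonarch:
  assumes S: "subring_of_type S" and nat: "\<And>n. N (of_nat n) \<le> 1"
  shows "\<phi> \<in> affine_line_set S N \<longleftrightarrow>
    \<phi> \<in> extensional (polys_over S) \<and> nonarch_seminorm (polys_over S) \<phi> \<and> (\<forall>a\<in>S. \<phi> [:a:] \<le> N a)"
proof safe
  assume y: "\<phi> \<in> affine_line_set S N"
  then show "\<phi> \<in> extensional (polys_over S)" and con: "\<And>a. a \<in> S \<Longrightarrow> \<phi> [:a:] \<le> N a"
    by (auto simp: affine_line_set_def)
  have "of_nat n \<in> S" for n by (induction n) (auto intro: subring_closed[OF S])
  then have "\<phi> (of_nat n) \<le> 1" for n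
    using con[of "of_nat n"] nat[of n] by (simp add: of_nat_poly)
  then show "nonarch_seminorm (polys_over S) \<phi>"
    using y multiplicative_seminorm_imp_nonarch[OF subring_polys_over[OF S], of \<phi>]
    by (auto simp: affine_line_set_def)
next
  assume y: "\<phi> \<in> extensional (polys_over S)" "nonarch_seminorm (polys_over S) \<phi>" "\<forall>a\<in>S. \<phi> [:a:] \<le> N a"
  interpret nonarch_seminorm "polys_over S" \<phi> by fact
  have "\<phi> (p + q) \<le> \<phi> p + \<phi> q" if "p \<in> polys_over S" "q \<in> polys_over S" for p q
    using ultra[OF that] nonneg that by (smt (verit))
  then show "\<phi> \<in> affine_line_set S N"
    using y closed(2) by (auto simp: affine_line_set_def multiplicative_seminorm_on_def
        zero one nonneg mult intro!: bexI[of _ 1])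
qed

section \<open>The Gauss norm\<close>

text \<open>For \<open>r > 0\<close> this is the norm of the disc of radius \<open>r\<close> around 0; for \<open>r = 0\<close> the convention
  \<open>0\<^sup>0 = 1\<close> makes it the value at the constant coefficient.\<close>
definition gauss_norm :: "('b::comm_ring_1 \<Rightarrow> real) \<Rightarrow> real \<Rightarrow> 'b poly \<Rightarrow> real" where
  "gauss_norm \<phi> r P = Max ((\<lambda>i. \<phi> (coeff P i) * r ^ i) ` {..degree P})"

lemma gauss_norm_const [simp]: "gauss_norm \<phi> r [:a:] = \<phi> a"
  by (simp add: gauss_norm_def)

lemma mult_strict_bound:
  fixes a b :: real
  assumes "0 \<le> a" "a \<le> a'" "0 \<le> b" "b \<le> b'" "0 < a'" "0 < b'" "a < a' \<or> b < b'"
  shows "a * b < a' * b'"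
proof (cases "a < a'")
  case True
  have "a * b \<le> a * b'" using assms by (intro mult_left_mono) auto
  also have "\<dots> < a' * b'" using True assms by (intro mult_strict_right_mono) auto
  finally show ?thesis .
next
  case False
  then have "a = a'" "b < b'" using assms by auto
  then show ?thesis using assms by (simp add: mult_strict_left_mono)
qed

context nonarch_seminorm
begin

lemma gauss_norm_nonneg:
  assumes "P \<in> polys_over A" "0 \<le> r" shows "0 \<le> gauss_norm \<phi> r P"
proof -
  have "0 \<le> \<phi> (coeff P 0) * r ^ 0" using assms nonneg by (simp add: polys_over_def)
  also have "\<dots> \<le> gauss_norm \<phi> r P"
    unfolding gauss_norm_def by (intro Max_ge image_eqI[of _ _ 0]) auto
  finally show ?thesis .
qed

lemma gauss_norm_ge:
  assumes "P \<in> polys_over A" "0 \<le> r" shows "\<phi> (coeff P i) * r ^ i \<le> gauss_norm \<phi> r P"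
proof (cases "i \<le> degree P")
  case True
  then show ?thesis unfolding gauss_norm_def by (intro Max_ge) auto
next
  case False
  then show ?thesis using gauss_norm_nonneg[OF assms] by (simp add: coeff_eq_0 zero)
qed

lemma gauss_norm_le:
  assumes "\<And>i. \<phi> (coeff P i) * r ^ i \<le> M" shows "gauss_norm \<phi> r P \<le> M"
  unfolding gauss_norm_def using assms by (subst Max_le_iff) auto

text \<open>The first index at which the maximum is attained; the strictness before it isolates one
  dominant term in the proof of multiplicativity.\<close>
lemma gauss_norm_first:
  assumes "P \<in> polys_over A" "0 \<le> r"
  obtains i where "\<phi> (coeff P i) * r ^ i = gauss_norm \<phi> r P"
    "\<And>k. k < i \<Longrightarrow> \<phi> (coeff P k) * r ^ k < gauss_norm \<phi> r P"
proof -
  have "gauss_norm \<phi> r P \<in> (\<lambda>i. \<phi> (coeff P i) * r ^ i) ` {..degree P}"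
    unfolding gauss_norm_def by (intro Max_in) auto
  then have ex: "\<exists>i. \<phi> (coeff P i) * r ^ i = gauss_norm \<phi> r P" by force
  show ?thesis
  proof
    show "\<phi> (coeff P (LEAST i. \<phi> (coeff P i) * r ^ i = gauss_norm \<phi> r P)) *
        r ^ (LEAST i. \<phi> (coeff P i) * r ^ i = gauss_norm \<phi> r P) = gauss_norm \<phi> r P"
      using LeastI_ex[OF ex] .
    show "\<phi> (coeff P k) * r ^ k < gauss_norm \<phi> r P"
      if "k < (LEAST i. \<phi> (coeff P i) * r ^ i = gauss_norm \<phi> r P)" for k
      using not_less_Least[OF that] gauss_norm_ge[OF assms, of k] by simp
  qed
qed

text \<open>Gauss's lemma. If \<open>i\<close> and \<open>j\<close> are the first indices where the two maxima are attained, then in the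
  coefficient of the product at \<open>i + j\<close> the term \<open>P\<^sub>i Q\<^sub>j\<close> strictly dominates all others.\<close>
lemma gauss_norm_mult:
  assumes P: "P \<in> polys_over A" and Q: "Q \<in> polys_over A" and r: "0 \<le> r"
  shows "gauss_norm \<phi> r (P * Q) = gauss_norm \<phi> r P * gauss_norm \<phi> r Q"
proof (rule antisym)
  let ?g = "gauss_norm \<phi> r"
  have PA: "coeff P k \<in> A" and QA: "coeff Q k \<in> A" for k
    using P Q by (auto simp: polys_over_def)
  have PQ: "P * Q \<in> polys_over A"
    using subring_closed(6)[OF subring_polys_over[OF subring]] P Q by blast
  have nn: "0 \<le> ?g P" "0 \<le> ?g Q" using gauss_norm_nonneg P Q r by auto
  have term_le: "\<phi> (coeff P k * coeff Q l) * r ^ (k + l) \<le> ?g P * ?g Q" for k l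
  proof -
    have "\<phi> (coeff P k * coeff Q l) * r ^ (k + l) = (\<phi> (coeff P k) * r ^ k) * (\<phi> (coeff Q l) * r ^ l)"
      by (simp add: mult PA QA power_add)
    also have "\<dots> \<le> ?g P * ?g Q"
      by (intro mult_mono gauss_norm_ge[OF P r] gauss_norm_ge[OF Q r]) (auto simp: nonneg QA r nn)
    finally show ?thesis .
  qed
  show "?g (P * Q) \<le> ?g P * ?g Q"
  proof (rule gauss_norm_le)
    fix n
    show "\<phi> (coeff (P * Q) n) * r ^ n \<le> ?g P * ?g Q"
    proof (cases "r ^ n = 0")
      case True
      have "\<phi> (coeff (P * Q) n) * r ^ n = 0" unfolding True by (rule mult_zero_right)
      then show ?thesis using mult_nonneg_nonneg[OF nn] by linarith
    next
      case False
      then have rn: "0 < r ^ n" using zero_le_power[OF r, of n] by linarith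
      have "\<phi> (coeff (P * Q) n) \<le> ?g P * ?g Q / r ^ n"
        unfolding coeff_mult
      proof (rule sum_le)
        fix i assume "i \<in> {..n}"
        then show "\<phi> (coeff P i * coeff Q (n - i)) \<le> ?g P * ?g Q / r ^ n"
          using term_le[of i "n - i"] rn by (simp add: field_simps)
      qed (auto intro!: closed(6) PA QA divide_nonneg_pos mult_nonneg_nonneg nn rn)
      then show ?thesis using rn by (simp add: field_simps)
    qed
  qed
  show "?g P * ?g Q \<le> ?g (P * Q)"
  proof (cases "?g P * ?g Q = 0")
    case True then show ?thesis using gauss_norm_nonneg[OF PQ r] by (simp only:)
  next
    case False
    then have pos: "0 < ?g P" "0 < ?g Q" using nn by (auto simp: order_less_le)
    obtain i where i: "\<phi> (coeff P i) * r ^ i = ?g P" "\<And>k. k < i \<Longrightarrow> \<phi> (coeff P k) * r ^ k < ?g P"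
      using gauss_norm_first[OF P r] by blast
    obtain j where j: "\<phi> (coeff Q j) * r ^ j = ?g Q" "\<And>k. k < j \<Longrightarrow> \<phi> (coeff Q k) * r ^ k < ?g Q"
      using gauss_norm_first[OF Q r] by blast
    let ?n = "i + j"
    have top: "\<phi> (coeff P i * coeff Q j) * r ^ ?n = ?g P * ?g Q"
      unfolding i(1)[symmetric] j(1)[symmetric] by (simp add: mult PA QA power_add)
    have rn: "0 < r ^ ?n"
    proof -
      have "r ^ ?n \<noteq> 0" using top pos by (metis mult_zero_right mult_pos_pos less_irrefl)
      then show ?thesis using zero_le_power[OF r, of ?n] by linarith
    qed
    have M: "0 < \<phi> (coeff P i * coeff Q j)"
      using mult_pos_pos[OF pos] rn unfolding top[symmetric] by (rule zero_less_mult_pos2)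
    have small: "\<phi> (\<Sum>k\<in>{..?n} - {i}. coeff P k * coeff Q (?n - k)) < \<phi> (coeff P i * coeff Q j)"
    proof (rule sum_less)
      fix k assume k: "k \<in> {..?n} - {i}"
      have "\<phi> (coeff P k * coeff Q (?n - k)) * r ^ (k + (?n - k)) < ?g P * ?g Q"
      proof -
        have eq: "\<phi> (coeff P k * coeff Q (?n - k)) * r ^ (k + (?n - k)) =
            (\<phi> (coeff P k) * r ^ k) * (\<phi> (coeff Q (?n - k)) * r ^ (?n - k))"
          by (simp add: mult PA QA power_add del: le_add_diff_inverse)
        have "k < i \<or> ?n - k < j" using k by auto
        then show ?thesis unfolding eq
          by (intro mult_strict_bound gauss_norm_ge[OF P r] gauss_norm_ge[OF Q r] pos)
            (use i(2) j(2) in \<open>auto simp: nonneg PA QA r\<close>)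
      qed
      moreover have "k + (?n - k) = ?n" using k by simp
      ultimately show "\<phi> (coeff P k * coeff Q (?n - k)) < \<phi> (coeff P i * coeff Q j)"
        unfolding top[symmetric] using rn by (simp only: mult_less_cancel_right_pos)
    qed (auto intro!: closed(6) PA QA M)
    have "coeff (P * Q) ?n = coeff P i * coeff Q j + (\<Sum>k\<in>{..?n} - {i}. coeff P k * coeff Q (?n - k))"
      unfolding coeff_mult by (subst sum.remove[of _ i]) auto
    then have "\<phi> (coeff (P * Q) ?n) = \<phi> (coeff P i * coeff Q j)"
      using small by (simp add: dominant closed(6)[OF PA QA] closed(7)[of _ "\<lambda>k. coeff P k * coeff Q (?n - k)", OF closed(6)[OF PA QA]])
    then show ?thesis using gauss_norm_ge[OF PQ r, of ?n] top by simp
  qed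
qed

lemma nonarch_gauss_norm:
  assumes r: "0 \<le> r" shows "nonarch_seminorm (polys_over A) (gauss_norm \<phi> r)"
proof
  show "subring_of_type (polys_over A)" by (rule subring_polys_over[OF subring])
  show "gauss_norm \<phi> r 0 = 0" "gauss_norm \<phi> r 1 = 1"
    by (simp_all add: gauss_norm_def zero one)
  fix P Q assume P: "P \<in> polys_over A" and Q: "Q \<in> polys_over A"
  show "0 \<le> gauss_norm \<phi> r P" by (rule gauss_norm_nonneg[OF P r])
  show "gauss_norm \<phi> r (P * Q) = gauss_norm \<phi> r P * gauss_norm \<phi> r Q"
    by (rule gauss_norm_mult[OF P Q r])
  show "gauss_norm \<phi> r (P + Q) \<le> max (gauss_norm \<phi> r P) (gauss_norm \<phi> r Q)"
  proof (rule gauss_norm_le)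
    fix i
    have "\<phi> (coeff (P + Q) i) * r ^ i \<le> max (\<phi> (coeff P i)) (\<phi> (coeff Q i)) * r ^ i"
      using P Q r by (intro mult_right_mono) (auto simp: polys_over_def ultra)
    also have "\<dots> \<le> max (gauss_norm \<phi> r P) (gauss_norm \<phi> r Q)"
      using gauss_norm_ge[OF P r, of i] gauss_norm_ge[OF Q r, of i] by (auto simp: max_def)
    finally show "\<phi> (coeff (P + Q) i) * r ^ i \<le> max (gauss_norm \<phi> r P) (gauss_norm \<phi> r Q)" .
  qed
qed

lemma (in nonarch_seminorm) gauss_norm_linear:
  assumes "a \<in> A" "b \<in> A" "0 \<le> r"
  shows "gauss_norm \<phi> r [:b, a:] = max (\<phi> b) (\<phi> a * r)"
proof (cases "a = 0")
  case True
  then show ?thesis using nonneg[OF assms(2)] by (simp add: zero)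
next
  case False
  then show ?thesis by (simp add: gauss_norm_def atMost_Suc max.commute)
qed

end

section \<open>Taylor expansion\<close>

text \<open>The substitution \<open>t \<mapsto> t + u\<close>, with values in polynomials in \<open>u\<close> over the ring of polynomials
  in \<open>t\<close>; the coefficient at \<open>u\<^sup>i\<close> is the \<open>i\<close>-th Hasse derivative.\<close>
definition taylor :: "'a::comm_ring_1 poly \<Rightarrow> 'a poly poly" where
  "taylor p = pcompose (map_poly (\<lambda>a. [:a:]) p) [:[:0, 1:], 1:]"

lemma taylor_pCons: "taylor (pCons a p) = [:[:a:]:] + [:[:0, 1:], 1:] * taylor p"
  by (simp add: taylor_def map_poly_pCons pcompose_pCons)

lemma taylor_0 [simp]: "taylor 0 = 0" by (simp add: taylor_def)

lemma taylor_linear: "taylor [:b, a:] = [:[:b, a:], [:a:]:]"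
  by (simp add: taylor_pCons)

lemma taylor_const: "taylor [:a:] = [:[:a:]:]"
  by (simp add: taylor_pCons)

lemma taylor_add: "taylor (p + q) = taylor p + taylor q"
proof -
  have "map_poly (\<lambda>a. [:a:]) (p + q) = map_poly (\<lambda>a. [:a:]) p + map_poly (\<lambda>a. [:a:]) q"
    by (intro poly_eqI) (simp add: coeff_map_poly)
  then show ?thesis by (simp add: taylor_def pcompose_add)
qed

lemma taylor_smult: "taylor (smult a p) = [:[:a:]:] * taylor p"
  by (induction p) (simp_all add: taylor_pCons algebra_simps)

lemma taylor_mult: "taylor (p * q) = taylor p * taylor q"
proof (induction p)
  case (pCons a p)
  have "taylor (pCons a p * q) = taylor (smult a q) + taylor (pCons 0 (p * q))"
    by (simp add: taylor_add)
  also have "\<dots> = taylor (pCons a p) * taylor q"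
    by (simp only: taylor_smult pCons taylor_pCons) (simp add: algebra_simps)
  finally show ?case .
qed simp

lemma pCons_mem:
  assumes "subring_of_type A"
  shows "pCons b p \<in> polys_over A \<longleftrightarrow> b \<in> A \<and> p \<in> polys_over A"
  unfolding polys_over_def mem_Collect_eq coeff_pCons
  by (auto split: nat.splits)

lemma linear_mem:
  assumes "subring_of_type A"
  shows "[:b, a:] \<in> polys_over A \<longleftrightarrow> a \<in> A \<and> b \<in> A" "[:a:] \<in> polys_over A \<longleftrightarrow> a \<in> A"
proof -
  have "0 \<in> polys_over A" using subring_closed(1)[OF assms] by (simp add: polys_over_def)
  then show "[:b, a:] \<in> polys_over A \<longleftrightarrow> a \<in> A \<and> b \<in> A" "[:a:] \<in> polys_over A \<longleftrightarrow> a \<in> A"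
    by (auto simp: pCons_mem[OF assms])
qed

lemma taylor_mem:
  assumes A: "subring_of_type A" "p \<in> polys_over A"
  shows "taylor p \<in> polys_over (polys_over A)"
  using A(2)
proof (induction p)
  case 0
  then show ?case using subring_closed(1)[OF subring_polys_over[OF A(1)]] by (simp add: polys_over_def)
next
  case (pCons a p)
  note B = subring_polys_over[OF A(1)]
  note C = subring_polys_over[OF B]
  from pCons show ?case
    unfolding taylor_pCons pCons_mem[OF A(1)]
    by (intro subring_closed(4,6)[OF C])
       (auto simp: pCons_mem[OF A(1)] pCons_mem[OF B] subring_closed[OF A(1)] subring_closed[OF B] subring_closed[OF C])
qed

section \<open>Points of the line and their restrictions to constants\<close>

text \<open>The element \<open>c\<close> measures how a seminorm restricts to \<open>R\<close>: by \<open>pts_const\<close> below, the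
  single number \<open>y [:c:]\<close> determines the values of a point \<open>y\<close> on all constants.\<close>
locale valued_line = complete_valuation_ring R N
  for R :: "'k::alg_closed_field set" and N +
  fixes c :: 'k
  assumes c_pos: "0 < N c" and c_less: "N c < 1"
begin

abbreviation "PR \<equiv> polys_over R"
abbreviation "pts \<equiv> affine_line_set R N"
abbreviation "X \<equiv> affine_line R N"

lemma R_iff: "a \<in> R \<longleftrightarrow> N a \<le> 1" by (simp add: norm_le_1_iff)

lemma subring_R: "subring_of_type R"
  using valuation_ring by (simp add: valuation_ring_def)

lemma subring_PR: "subring_of_type PR"
  by (rule subring_polys_over[OF subring_R])

lemmas R_closed = subring_closed[OF subring_R]
lemmas PR_closed = subring_closed[OF subring_PR]
lemmas lin_PR [simp] = linear_mem[OF subring_R]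

lemma N_nonneg [simp]: "0 \<le> N x"
  using norm_0 norm_pos[of x] by (cases "x = 0") auto

lemma N_seminorm: "nonarch_seminorm UNIV N"
  using nonarch nonarch_norm_1[OF nonarch]
  by unfold_locales (auto simp: nonarch_norm_def subring_UNIV)

sublocale N: nonarch_seminorm UNIV N by (rule N_seminorm)

lemma N_eq_0 [simp]: "N x = 0 \<longleftrightarrow> x = 0"
  using norm_0 norm_pos[of x] by (cases "x = 0") auto

declare norm_0 [simp]

lemma N_power: "N (x ^ n) = N x ^ n"
  by (induction n) (simp_all add: N.one norm_mult)

lemma N_divide: "N (x / y) = N x / N y"
proof (cases "y = 0")
  case False
  then show ?thesis using norm_mult[of "x / y" y] norm_pos[of y] by (simp add: field_simps)
qed (simp add: norm_0)

lemma c_facts: "N c \<noteq> 0" "N c \<le> 1" "c \<in> R" "c \<noteq> 0" "ln (N c) < 0"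
  using c_pos c_less by (auto simp: R_iff norm_0)

lemma N_of_nat_le: "N (of_nat n) \<le> 1"
proof -
  have "of_nat n \<in> R" by (induction n) (auto intro: R_closed)
  then show ?thesis by (simp add: R_iff)
qed

lemma affine_line_set_iff:
  "y \<in> pts \<longleftrightarrow> y \<in> extensional PR \<and> nonarch_seminorm PR y \<and> (\<forall>a\<in>R. y [:a:] \<le> N a)"
  by (rule affine_line_set_nonarch[OF subring_R]) (rule N_of_nat_le)

lemma pts_nonarch: "y \<in> pts \<Longrightarrow> nonarch_seminorm PR y"
  and pts_ext: "y \<in> pts \<Longrightarrow> y \<in> extensional PR"
  and pts_contractive: "y \<in> pts \<Longrightarrow> a \<in> R \<Longrightarrow> y [:a:] \<le> N a"
  by (auto simp: affine_line_set_iff)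

lemma topspace_X [simp]: "topspace X = pts"
  by (auto simp: affine_line_def affine_line_set_iff PiE_iff intro: extensional_arb)

lemma pts_mult: "y \<in> pts \<Longrightarrow> p \<in> PR \<Longrightarrow> q \<in> PR \<Longrightarrow> y (p * q) = y p * y q"
  by (rule nonarch_seminorm.mult[OF pts_nonarch])

lemma pts_nonneg: "y \<in> pts \<Longrightarrow> p \<in> PR \<Longrightarrow> 0 \<le> y p"
  by (rule nonarch_seminorm.nonneg[OF pts_nonarch])

lemma pts_one: "y \<in> pts \<Longrightarrow> y 1 = 1"
  by (rule nonarch_seminorm.one[OF pts_nonarch])

definition expo :: "'k \<Rightarrow> real" where "expo a = ln (N a) / ln (N c)"

text \<open>The norm \<open>N a ^ s\<close>, where \<open>\<sigma> = N c ^ s\<close>. The parameter \<open>\<sigma>\<close> replaces \<open>s\<close> because \<open>s = \<infinity>\<close>, the trivial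
  norm of the residue field, becomes the ordinary value \<open>\<sigma> = 0\<close>. Units are treated separately since
  \<open>0 powr 0 = 0\<close>.\<close>
definition const_norm :: "real \<Rightarrow> 'k \<Rightarrow> real" where
  "const_norm \<sigma> a = (if a = 0 then 0 else if N a = 1 then 1 else \<sigma> powr expo a)"

lemma expo_nonneg: "a \<in> R \<Longrightarrow> a \<noteq> 0 \<Longrightarrow> 0 \<le> expo a"
  using c_facts norm_pos[of a] by (auto simp: expo_def R_iff intro!: divide_nonpos_neg)

lemma expo_pos: "a \<in> R \<Longrightarrow> a \<noteq> 0 \<Longrightarrow> N a \<noteq> 1 \<Longrightarrow> 0 < expo a"
  using c_facts norm_pos[of a] by (auto simp: expo_def R_iff intro!: divide_neg_neg)

lemma expo_mult: "a \<noteq> 0 \<Longrightarrow> b \<noteq> 0 \<Longrightarrow> expo (a * b) = expo a + expo b"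
  using norm_pos[of a] norm_pos[of b] by (simp add: expo_def norm_mult ln_mult add_divide_distrib)

lemma expo_antimono: "a \<noteq> 0 \<Longrightarrow> N a \<le> N b \<Longrightarrow> expo b \<le> expo a"
  using c_facts norm_pos[of a] by (auto simp: expo_def intro!: divide_right_mono_neg)

lemma const_norm_simps [simp]:
  "const_norm \<sigma> 0 = 0" "const_norm \<sigma> 1 = 1" "N a = 1 \<Longrightarrow> const_norm \<sigma> a = 1"
  by (auto simp: const_norm_def N.one norm_0)

lemma const_norm_Nc: "const_norm (N c) a = N a"
  using c_facts norm_pos[of a] c_pos by (auto simp: const_norm_def expo_def powr_def norm_0)

lemma const_norm_0: "a \<in> R \<Longrightarrow> const_norm 0 a = (if N a = 1 then 1 else 0)"
  by (auto simp: const_norm_def norm_0)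

lemma const_norm_nonneg: "0 \<le> const_norm \<sigma> a"
  by (simp add: const_norm_def)

lemma const_norm_mono: "a \<in> R \<Longrightarrow> 0 \<le> \<sigma> \<Longrightarrow> \<sigma> \<le> \<tau> \<Longrightarrow> const_norm \<sigma> a \<le> const_norm \<tau> a"
  by (auto simp: const_norm_def expo_nonneg intro!: powr_mono2)

lemma const_norm_le_N: "a \<in> R \<Longrightarrow> 0 \<le> \<sigma> \<Longrightarrow> \<sigma> \<le> N c \<Longrightarrow> const_norm \<sigma> a \<le> N a"
  using const_norm_mono[of a \<sigma> "N c"] by (simp add: const_norm_Nc)

lemma const_norm_powr: "a \<in> R \<Longrightarrow> 0 \<le> \<sigma> \<Longrightarrow> const_norm (\<sigma> powr k) a = const_norm \<sigma> a powr k"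
  by (simp add: const_norm_def powr_powr mult.commute)

lemma continuous_on_const_norm: "a \<in> R \<Longrightarrow> continuous_on {0..} (\<lambda>\<sigma>. const_norm \<sigma> a)"
proof (cases "a = 0 \<or> N a = 1")
  case False
  assume "a \<in> R"
  with False have "0 < expo a" by (simp add: expo_pos)
  then have "continuous_on {0..} (\<lambda>\<sigma>. \<sigma> powr expo a)"
    by (intro continuous_on_powr' continuous_intros) auto
  with False show ?thesis by (simp add: const_norm_def)
qed auto

lemma const_norm_mono_N:
  assumes "a \<in> R" "b \<in> R" "N a \<le> N b" "0 \<le> \<sigma>" "\<sigma> \<le> N c"
  shows "const_norm \<sigma> a \<le> const_norm \<sigma> b"
proof (cases "a = 0 \<or> N b = 1")
  case True
  then show ?thesis using assms const_norm_le_N[of a \<sigma>] by (auto simp: const_norm_nonneg R_iff)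
next
  case False
  then have "b \<noteq> 0" "N a \<noteq> 1" using assms norm_pos[of a] by (auto simp: R_iff)
  then show ?thesis
    using False assms c_less expo_antimono[of a b]
    by (cases "\<sigma> = 0") (auto simp: const_norm_def intro!: powr_mono')
qed

lemma const_norm_seminorm:
  assumes "0 \<le> \<sigma>" "\<sigma> \<le> N c"
  shows "nonarch_seminorm R (const_norm \<sigma>)"
proof
  fix a b assume a: "a \<in> R" and b: "b \<in> R"
  show "const_norm \<sigma> (a * b) = const_norm \<sigma> a * const_norm \<sigma> b"
  proof (cases "a = 0 \<or> b = 0")
    case False
    then have nz: "a \<noteq> 0" "b \<noteq> 0" by auto
    have ab: "N a \<le> 1" "N b \<le> 1" using a b by (auto simp: R_iff)
    \<comment> \<open>A product of elements of \<open>R\<close> is a unit only if both factors are.\<close>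
    have [simp]: "N (a * b) = 1 \<longleftrightarrow> N a = 1 \<and> N b = 1"
    proof
      assume "N (a * b) = 1"
      then have "N a * N b = 1" by (simp add: norm_mult)
      moreover have "N a * N b \<le> N a" "N a * N b \<le> N b"
        using ab by (simp_all add: mult_left_le mult_left_le_one_le)
      ultimately show "N a = 1 \<and> N b = 1" using ab by linarith
    qed (simp add: norm_mult)
    have e: "N x = 1 \<Longrightarrow> expo x = 0" for x by (simp add: expo_def)
    show ?thesis using nz by (auto simp: const_norm_def expo_mult powr_add e)
  qed auto
  show "const_norm \<sigma> (a + b) \<le> max (const_norm \<sigma> a) (const_norm \<sigma> b)"
    using const_norm_mono_N[of "a + b" a \<sigma>] const_norm_mono_N[of "a + b" b \<sigma>] N.ultra[of a b] a b assms
      R_closed(4)[of a b]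
    by (auto simp: max_def split: if_splits)
qed (simp_all add: subring_R const_norm_nonneg)

lemma pts_const_mono:
  assumes y: "y \<in> pts" and ab: "a \<in> R" "b \<in> R" "N a \<le> N b"
  shows "y [:a:] \<le> y [:b:]"
proof (cases "b = 0")
  case True
  then have "a = 0" using ab N_nonneg[of a] by (metis N_eq_0 norm_0 order_antisym)
  then show ?thesis using True by simp
next
  case False
  interpret nonarch_seminorm PR y by (rule pts_nonarch[OF y])
  have q: "a / b \<in> R" using ab False norm_pos[of b] by (simp add: R_iff N_divide)
  have "y [:a:] = y ([:a / b:] * [:b:])" using False by simp
  also have "\<dots> = y [:a / b:] * y [:b:]" using q ab by (intro mult) auto
  also have "\<dots> \<le> 1 * y [:b:]"
    using pts_contractive[OF y q] q ab by (intro mult_right_mono nonneg) (auto simp: R_iff)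
  finally show ?thesis by simp
qed

lemma pts_const_power:
  assumes y: "y \<in> pts" and a: "a \<in> R"
  shows "y [:a ^ n:] = y [:a:] ^ n"
proof -
  interpret nonarch_seminorm PR y by (rule pts_nonarch[OF y])
  show ?thesis
  proof (induction n)
    case (Suc n)
    have "[:a ^ Suc n:] = [:a:] * [:a ^ n:]" by simp
    then show ?case using mult[of "[:a:]" "[:a ^ n:]"] a Suc subring_power[OF subring_R a]
      by (simp only: lin_PR) (simp add: mult.commute)
  qed (simp add: one flip: one_pCons)
qed

lemma pts_c: "y \<in> pts \<Longrightarrow> 0 \<le> y [:c:]" "y \<in> pts \<Longrightarrow> y [:c:] \<le> N c"
  using nonarch_seminorm.nonneg[OF pts_nonarch] pts_contractive c_facts by auto

text \<open>On \<open>R\<close> the values of \<open>y\<close> are a monotone function of the values of \<open>N\<close>. Comparing powers of \<open>a\<close> with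
  powers of \<open>c\<close> shows that \<open>ln (y a) / ln (y c)\<close> and \<open>ln (N a) / ln (N c)\<close> lie on the same side of every
  rational number, so they are equal.\<close>
lemma pts_const:
  assumes y: "y \<in> pts" and a: "a \<in> R"
  shows "y [:a:] = const_norm (y [:c:]) a"
proof -
  interpret nonarch_seminorm PR y by (rule pts_nonarch[OF y])
  let ?\<sigma> = "y [:c:]"
  have cR: "c \<in> R" by (rule c_facts)
  have \<sigma>: "0 \<le> ?\<sigma>" "?\<sigma> < 1" using pts_c[OF y] c_less by auto
  have ya: "0 \<le> y [:a:]" "y [:a:] \<le> N a" using nonneg a pts_contractive[OF y a] by auto
  consider "a = 0" | "N a = 1" | "a \<noteq> 0" "N a < 1" using a by (force simp: R_iff)
  then show ?thesis
  proof cases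
    case 1 then show ?thesis by (simp add: zero)
  next
    case 2
    have "y [:1:] = y [:a:]"
      using pts_const_mono[OF y, of 1 a] pts_const_mono[OF y, of a 1] 2 a R_closed(2) by (simp add: N.one)
    then show ?thesis using 2 one by (simp add: one_pCons)
  next
    case 3
    then have Na: "0 < N a" "N a < 1" using norm_pos by auto
    show ?thesis
    proof (cases "?\<sigma> = 0")
      case True
      \<comment> \<open>A power of \<open>a\<close> is divisible by \<open>c\<close>, on which \<open>y\<close> vanishes.\<close>
      obtain j where "N a ^ j < N c" using real_arch_pow_inv[OF c_pos Na(2)] by blast
      then have "y [:a:] ^ j \<le> 0"
        using pts_const_mono[OF y, of "a ^ j" c] True cR a
        by (simp add: pts_const_power[OF y a] N_power subring_power[OF subring_R])
      then have "y [:a:] = 0" using ya by (metis le_less power_le_zero_eq not_less)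
      then show ?thesis using 3 True by (simp add: const_norm_def)
    next
      case False
      then have \<sigma>: "0 < ?\<sigma>" "?\<sigma> < 1" using \<sigma> by auto
      have ya0: "0 < y [:a:]"
      proof -
        obtain j where "N c ^ j < N a" using real_arch_pow_inv[OF Na(1) c_less] by blast
        then have "?\<sigma> ^ j \<le> y [:a:]"
          using pts_const_mono[OF y, of "c ^ j" a] cR a
          by (simp add: pts_const_power[OF y cR] N_power subring_power[OF subring_R])
        then show ?thesis using \<sigma> by (meson less_le_trans zero_less_power)
      qed
      define L where "L = ln (y [:a:]) / ln ?\<sigma>"
      have ln\<sigma>: "ln ?\<sigma> < 0" and lnc: "ln (N c) < 0" using \<sigma> c_facts by auto
      have L0: "0 \<le> L" unfolding L_def using ya Na ya0 ln\<sigma> by (intro divide_nonpos_nonpos) auto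
      \<comment> \<open>Cross-multiplied, a bound \<open>p / q\<close> on \<open>expo a\<close> compares \<open>a ^ q\<close> with \<open>c ^ p\<close>; then so do the
        values of \<open>y\<close>.\<close>
      have le: "real p / real q \<le> L" if "real p / real q \<le> expo a" "q > 0" for p q :: nat
      proof -
        have "real q * ln (N a) \<le> real p * ln (N c)"
          using that lnc by (simp add: expo_def field_simps)
        then have "N (a ^ q) \<le> N (c ^ p)"
          using Na c_pos by (simp add: N_power flip: ln_realpow ln_le_cancel_iff)
        then have "y [:a:] ^ q \<le> ?\<sigma> ^ p"
          using pts_const_mono[OF y, of "a ^ q" "c ^ p"] a cR
          by (simp add: pts_const_power[OF y] subring_power[OF subring_R])
        then have "real q * ln (y [:a:]) \<le> real p * ln ?\<sigma>"
          using ya0 \<sigma> by (simp flip: ln_realpow)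
        then show ?thesis using ln\<sigma> that by (simp add: L_def field_simps)
      qed
      have ge: "L \<le> real p / real q" if "expo a \<le> real p / real q" "q > 0" for p q :: nat
      proof -
        have "real p * ln (N c) \<le> real q * ln (N a)"
          using that lnc by (simp add: expo_def field_simps)
        then have "N (c ^ p) \<le> N (a ^ q)"
          using Na c_pos by (simp add: N_power flip: ln_realpow ln_le_cancel_iff)
        then have "?\<sigma> ^ p \<le> y [:a:] ^ q"
          using pts_const_mono[OF y, of "c ^ p" "a ^ q"] a cR
          by (simp add: pts_const_power[OF y] subring_power[OF subring_R])
        then have "real p * ln ?\<sigma> \<le> real q * ln (y [:a:])"
          using ya0 \<sigma> by (simp flip: ln_realpow)
        then show ?thesis using ln\<sigma> that by (simp add: L_def field_simps)
      qed
      have rat: "\<exists>p q. t = real p / real q \<and> q > 0" if "t \<in> \<rat>" "0 \<le> t" for t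
        using Rats_abs_nat_div_natE[OF that(1)] that(2) by (metis abs_of_nonneg bot_nat_0.not_eq_extremum)
      have "L = expo a"
      proof (rule ccontr)
        assume "L \<noteq> expo a"
        then consider "L < expo a" | "expo a < L" by linarith
        then show False
        proof cases
          case 1
          then obtain t where t: "t \<in> \<rat>" "L < t" "t < expo a" using Rats_dense_in_real by blast
          then obtain p q where "t = real p / real q" "q > 0" using rat[of t] L0 by auto
          then show False using le[of p q] t by simp
        next
          case 2
          then obtain t where t: "t \<in> \<rat>" "expo a < t" "t < L" using Rats_dense_in_real by blast
          then obtain p q where "t = real p / real q" "q > 0"
            using rat[of t] expo_nonneg[OF a 3(1)] by auto
          then show False using ge[of p q] t by simp
        qed
      qed
      then have "ln (y [:a:]) = expo a * ln ?\<sigma>" using ln\<sigma> by (simp add: L_def field_simps)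
      then have "y [:a:] = ?\<sigma> powr expo a" using ya0 \<sigma> by (simp add: powr_def) (metis exp_ln)
      then show ?thesis using 3 by (simp add: const_norm_def)
    qed
  qed
qed

section \<open>Linear polynomials as coordinates\<close>

text \<open>A root \<open>x\<close> with \<open>N x \<le> 1\<close> gives the factor \<open>t - x\<close>, and any other root the factor \<open>x\<^sup>-\<^sup>1 t - 1\<close>. Both
  have Gauss norm 1, so by multiplicativity the cofactor has Gauss norm at most 1, that is, its
  coefficients lie in \<open>R\<close>.\<close>
lemma linear_factor:
  assumes p: "p \<in> PR" and deg: "degree p > 0"
  obtains a b q where "a \<in> R" "b \<in> R" "q \<in> PR" "p = [:b, a:] * q" "degree q < degree p"
proof -
  obtain x where "poly p x = 0" using alg_closed_imp_poly_has_root[OF deg] by blast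
  then obtain q where q: "p = [:- x, 1:] * q" by (metis poly_eq_0_iff_dvd dvdE)
  obtain b a q' where ab: "p = [:b, a:] * q'" "N a \<le> 1" "N b \<le> 1" "N a = 1 \<or> N b = 1" "a \<noteq> 0"
  proof (cases "N x \<le> 1")
    case True
    then show ?thesis by (intro that[of "- x" 1 q, OF q]) (simp_all add: N.uminus N.one)
  next
    case False
    then have "x \<noteq> 0" using norm_0 by auto
    then have "[:- x, 1:] = smult x [:- 1, 1 / x:]" by simp
    then have p': "p = [:- 1, 1 / x:] * smult x q"
      unfolding q by (simp only: mult_smult_left mult_smult_right)
    moreover have "N (1 / x) \<le> 1" using False by (simp add: N_divide N.one)
    ultimately show ?thesis using \<open>x \<noteq> 0\<close>
      by (intro that[of "- 1" "1 / x" "smult x q", OF p']) (simp_all add: N.uminus N.one)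
  qed
  note g = N.gauss_norm_mult[of "[:b, a:]" q' 1]
  have U: "P \<in> polys_over UNIV" for P :: "'k poly" by (simp add: polys_over_def)
  have "gauss_norm N 1 [:b, a:] = 1"
    using ab by (auto simp: gauss_norm_def atMost_Suc)
  moreover have "gauss_norm N 1 p \<le> 1"
    by (rule N.gauss_norm_le) (use p in \<open>auto simp: polys_over_def R_iff\<close>)
  ultimately have "gauss_norm N 1 q' \<le> 1" using g U ab(1) by simp
  then have "N (coeff q' i) \<le> 1" for i
    using N.gauss_norm_ge[of q' 1 i] U by simp
  then have "q' \<in> PR" by (simp add: polys_over_def R_iff)
  moreover have "degree q' < degree p"
  proof -
    have "q' \<noteq> 0" using deg ab(1) by auto
    then have "degree p = degree [:b, a:] + degree q'" unfolding ab(1) using ab(5) by (intro degree_mult_eq) auto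
    then show ?thesis using ab(5) by simp
  qed
  ultimately show ?thesis using that ab by (simp add: R_iff)
qed

text \<open>The multiplicative monoid of \<open>R[t]\<close> is generated by the polynomials \<open>a t + b\<close>. Thus points are
  determined by their values there, and so are continuity and neighbourhoods.\<close>
lemma PR_induct [consumes 1, case_names linear mult]:
  assumes "p \<in> PR"
    and lin: "\<And>a b. a \<in> R \<Longrightarrow> b \<in> R \<Longrightarrow> P [:b, a:]"
    and mult: "\<And>p q. p \<in> PR \<Longrightarrow> q \<in> PR \<Longrightarrow> P p \<Longrightarrow> P q \<Longrightarrow> P (p * q)"
  shows "P p"
  using assms(1)
proof (induction "degree p" arbitrary: p rule: less_induct)
  case less
  show ?case
  proof (cases "degree p = 0")
    case True
    then obtain b where "p = [:b:]" by (rule degree_eq_zeroE)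
    \<comment> \<open>Constants count as linear polynomials with \<open>a = 0\<close>.\<close>
    then show ?thesis using lin[of 0 b] less.prems R_closed(1) by simp
  next
    case False
    then obtain a b q where "a \<in> R" "b \<in> R" "q \<in> PR" "p = [:b, a:] * q" "degree q < degree p"
      using linear_factor[OF less.prems] by auto
    then show ?thesis using mult[OF _ _ lin[of a b] less.hyps[of q]] by simp
  qed
qed

lemma pts_eqI:
  assumes x: "x \<in> pts" and y: "y \<in> pts"
    and eq: "\<And>a b. a \<in> R \<Longrightarrow> b \<in> R \<Longrightarrow> x [:b, a:] = y [:b, a:]"
  shows "x = y"
proof (rule extensionalityI[OF pts_ext[OF x] pts_ext[OF y]])
  fix p assume "p \<in> PR"
  then show "x p = y p"
    by (induction rule: PR_induct)
      (simp_all add: eq nonarch_seminorm.mult[OF pts_nonarch[OF x]] nonarch_seminorm.mult[OF pts_nonarch[OF y]])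
qed

lemma continuous_map_coord: "p \<in> PR \<Longrightarrow> continuous_map X euclideanreal (\<lambda>y. y p)"
  unfolding affine_line_def
  by (intro continuous_map_from_subtopology continuous_map_product_projection)

text \<open>The coordinate at a product is the product of the coordinates.\<close>
lemma continuous_map_into_line:
  assumes f: "\<And>z. z \<in> topspace T \<Longrightarrow> f z \<in> pts"
    and lin: "\<And>a b. a \<in> R \<Longrightarrow> b \<in> R \<Longrightarrow> continuous_map T euclideanreal (\<lambda>z. f z [:b, a:])"
  shows "continuous_map T X f"
proof -
  have "continuous_map T euclideanreal (\<lambda>z. f z p)" if "p \<in> PR" for p
    using that
  proof (induction rule: PR_induct)
    case (mult p q)
    have "continuous_map T euclideanreal (\<lambda>z. f z p * f z q)"
      using mult by (intro continuous_map_real_mult)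
    then show ?case
      by (rule continuous_map_eq) (simp add: pts_mult f mult)
  qed (rule lin)
  then show ?thesis
    unfolding affine_line_def continuous_map_in_subtopology continuous_map_componentwise
    using f pts_ext by (auto simp: image_subset_iff)
qed

text \<open>A pair \<open>(b, a)\<close> stands for the polynomial \<open>[:b, a:]\<close>.\<close>
definition nbhd :: "('k poly \<Rightarrow> real) \<Rightarrow> ('k \<times> 'k) set \<Rightarrow> real \<Rightarrow> ('k poly \<Rightarrow> real) set" where
  "nbhd x D e = {y \<in> pts. \<forall>(b, a) \<in> D. \<bar>y [:b, a:] - x [:b, a:]\<bar> < e}"

lemma nbhd_subset: "nbhd x D e \<subseteq> pts" by (auto simp: nbhd_def)

lemma nbhd_self: "x \<in> pts \<Longrightarrow> 0 < e \<Longrightarrow> x \<in> nbhd x D e"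
  by (auto simp: nbhd_def)

lemma openin_coord_near:
  assumes "p \<in> PR" shows "openin X {y \<in> pts. \<bar>y p - t\<bar> < e}"
proof -
  have "openin X {y \<in> topspace X. y p \<in> {t - e<..<t + e}}"
    using assms by (intro openin_continuous_map_preimage[OF continuous_map_coord]) auto
  also have "{y \<in> topspace X. y p \<in> {t - e<..<t + e}} = {y \<in> pts. \<bar>y p - t\<bar> < e}"
    by (auto simp: abs_less_iff)
  finally show ?thesis .
qed

lemma openin_nbhd:
  assumes "finite D" "D \<subseteq> R \<times> R" shows "openin X (nbhd x D e)"
proof -
  have "nbhd x D e = (\<Inter>z\<in>D. {y \<in> pts. \<bar>y [:fst z, snd z:] - x [:fst z, snd z:]\<bar> < e}) \<inter> topspace X"
    by (auto simp: nbhd_def case_prod_beta)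
  also have "openin X \<dots>"
    using assms by (intro openin_INT openin_coord_near) auto
  finally show ?thesis .
qed

text \<open>The analogue of \<open>continuous_map_into_line\<close> for neighbourhoods, by continuity of
  multiplication on the reals.\<close>
lemma nbhd_controls_poly:
  assumes x: "x \<in> pts" and p: "p \<in> PR" and e: "0 < e"
  shows "\<exists>D d. finite D \<and> D \<subseteq> R \<times> R \<and> 0 < d \<and> (\<forall>y \<in> nbhd x D d. \<bar>y p - x p\<bar> < e)"
  using p e
proof (induction arbitrary: e rule: PR_induct)
  case (linear a b)
  then show ?case by (intro exI[of _ "{(b, a)}"] exI[of _ e]) (auto simp: nbhd_def)
next
  case (mult p q)
  have "isCont (\<lambda>z. fst z * snd z) (x p, x q)" by (intro continuous_intros)
  then obtain d where d: "0 < d" "\<And>z. dist z (x p, x q) < d \<Longrightarrow> dist (fst z * snd z) (x p * x q) < e"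
    using \<open>0 < e\<close> unfolding continuous_at_eps_delta by force
  obtain D1 d1 where 1: "finite D1" "D1 \<subseteq> R \<times> R" "0 < d1" "\<And>y. y \<in> nbhd x D1 d1 \<Longrightarrow> \<bar>y p - x p\<bar> < d / 2"
    using mult.IH(1)[of "d / 2"] d(1) by auto
  obtain D2 d2 where 2: "finite D2" "D2 \<subseteq> R \<times> R" "0 < d2" "\<And>y. y \<in> nbhd x D2 d2 \<Longrightarrow> \<bar>y q - x q\<bar> < d / 2"
    using mult.IH(2)[of "d / 2"] d(1) by auto
  show ?case
  proof (intro exI conjI ballI)
    show "finite (D1 \<union> D2)" "D1 \<union> D2 \<subseteq> R \<times> R" "0 < min d1 d2" using 1 2 by auto
    fix y assume "y \<in> nbhd x (D1 \<union> D2) (min d1 d2)"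
    then have y: "y \<in> pts" "y \<in> nbhd x D1 d1" "y \<in> nbhd x D2 d2" by (auto simp: nbhd_def)
    have "dist (y p, y q) (x p, x q) \<le> \<bar>y p - x p\<bar> + \<bar>y q - x q\<bar>"
      using sqrt_sum_squares_le_sum_abs[of "y p - x p" "y q - x q"] by (simp add: dist_prod_def dist_real_def)
    also have "\<dots> < d" using 1(4)[OF y(2)] 2(4)[OF y(3)] by simp
    finally show "\<bar>y (p * q) - x (p * q)\<bar> < e"
      using d(2)[of "(y p, y q)"] mult.hyps x y(1) by (simp add: pts_mult dist_real_def)
  qed
qed

lemma open_contains_nbhd:
  assumes U: "openin X U" and x: "x \<in> U"
  obtains D e where "finite D" "D \<subseteq> R \<times> R" "0 < e" "nbhd x D e \<subseteq> U"
proof -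
  have xp: "x \<in> pts" using openin_subset[OF U] x by auto
  obtain T where T: "openin (powertop_real PR) T" "U = T \<inter> pts"
    using U unfolding affine_line_def openin_subtopology by blast
  then have "\<exists>W. finite {i \<in> PR. W i \<noteq> UNIV} \<and> (\<forall>i\<in>PR. open (W i)) \<and> x \<in> Pi\<^sub>E PR W \<and> Pi\<^sub>E PR W \<subseteq> T"
    using x unfolding openin_product_topology_alt by (simp add: Ball_def)
  then obtain W where W: "finite {i \<in> PR. W i \<noteq> UNIV}" "\<And>i. i \<in> PR \<Longrightarrow> open (W i)"
      "x \<in> Pi\<^sub>E PR W" "Pi\<^sub>E PR W \<subseteq> T"
    by blast
  let ?I = "{i \<in> PR. W i \<noteq> UNIV}"
  have near: "\<exists>D d. finite D \<and> D \<subseteq> R \<times> R \<and> 0 < d \<and> (\<forall>y \<in> nbhd x D d. y p \<in> W p)" if "p \<in> ?I" for p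
  proof -
    have "x p \<in> W p" "open (W p)" using W that by auto
    then obtain e where "0 < e" "\<And>t. \<bar>t - x p\<bar> < e \<Longrightarrow> t \<in> W p"
      unfolding open_real by (metis open_real)
    then show ?thesis using nbhd_controls_poly[OF xp, of p e] that by (metis (no_types, lifting) mem_Collect_eq)
  qed
  then obtain D d where D: "\<And>p. p \<in> ?I \<Longrightarrow> finite (D p) \<and> D p \<subseteq> R \<times> R \<and> 0 < d p \<and> (\<forall>y \<in> nbhd x (D p) (d p). y p \<in> W p)"
  proof -
    assume *: "\<And>D d. (\<And>p. p \<in> ?I \<Longrightarrow> finite (D p) \<and> D p \<subseteq> R \<times> R \<and> 0 < d p \<and>
      (\<forall>y \<in> nbhd x (D p) (d p). y p \<in> W p)) \<Longrightarrow> thesis"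
    have "\<forall>p\<in>?I. \<exists>z. finite (fst z) \<and> fst z \<subseteq> R \<times> R \<and> 0 < snd z \<and> (\<forall>y \<in> nbhd x (fst z) (snd z). y p \<in> W p)"
    proof
      fix p assume "p \<in> ?I"
      from near[OF this] obtain D d where "finite D" "D \<subseteq> R \<times> R" "0 < d" "\<forall>y \<in> nbhd x D d. y p \<in> W p"
        by blast
      then show "\<exists>z. finite (fst z) \<and> fst z \<subseteq> R \<times> R \<and> 0 < snd z \<and> (\<forall>y \<in> nbhd x (fst z) (snd z). y p \<in> W p)"
        by (intro exI[of _ "(D, d)"]) simp
    qed
    then obtain z where "\<forall>p\<in>?I. finite (fst (z p)) \<and> fst (z p) \<subseteq> R \<times> R \<and> 0 < snd (z p) \<and>
        (\<forall>y \<in> nbhd x (fst (z p)) (snd (z p)). y p \<in> W p)"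
      using bchoice by (metis (no_types, lifting))
    then show thesis using *[of "fst \<circ> z" "snd \<circ> z"] by auto
  qed
  define e where "e = Min (insert 1 (d ` ?I))"
  have e: "0 < e" "\<And>p. p \<in> ?I \<Longrightarrow> e \<le> d p"
    unfolding e_def using W(1) D by auto
  show ?thesis
  proof
    show "finite (\<Union>(D ` ?I))" "\<Union>(D ` ?I) \<subseteq> R \<times> R" "0 < e" using W(1) D e by auto
    show "nbhd x (\<Union>(D ` ?I)) e \<subseteq> U"
    proof
      fix y assume y: "y \<in> nbhd x (\<Union>(D ` ?I)) e"
      then have yp: "y \<in> pts" by (simp add: nbhd_def)
      have "y p \<in> W p" if "p \<in> PR" for p
      proof (cases "p \<in> ?I")
        case True
        then have "y \<in> nbhd x (D p) (d p)" using y e(2)[OF True] by (fastforce simp: nbhd_def)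
        then show ?thesis using D[OF True] by blast
      qed (use that in auto)
      then have "y \<in> Pi\<^sub>E PR W" using pts_ext[OF yp] by (auto simp: PiE_iff)
      then show "y \<in> U" using T(2) W(4) yp by auto
    qed
  qed
qed

text \<open>A set \<open>nbhd x D e\<close> is an intersection of intervals in the coordinates. A path on which every
  coordinate stays between its two end values therefore cannot leave it. All paths below are
  composed of such paths.\<close>
lemma path_in_nbhd:
  fixes g :: "real \<Rightarrow> 'k poly \<Rightarrow> real"
  assumes g: "\<And>t. t \<in> {0..1} \<Longrightarrow> g t \<in> pts"
    and cont: "\<And>a b. a \<in> R \<Longrightarrow> b \<in> R \<Longrightarrow> continuous_on {0..1} (\<lambda>t. g t [:b, a:])"
    and between: "\<And>a b t. a \<in> R \<Longrightarrow> b \<in> R \<Longrightarrow> t \<in> {0..1} \<Longrightarrow>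
      min (g 0 [:b, a:]) (g 1 [:b, a:]) \<le> g t [:b, a:] \<and> g t [:b, a:] \<le> max (g 0 [:b, a:]) (g 1 [:b, a:])"
    and D: "D \<subseteq> R \<times> R" and ends: "g 0 \<in> nbhd x D e" "g 1 \<in> nbhd x D e"
  shows "path_component_of (subtopology X (nbhd x D e)) (g 0) (g 1)"
proof -
  have "g t \<in> nbhd x D e" if t: "t \<in> {0..1}" for t
    unfolding nbhd_def
  proof (intro CollectI conjI g t ballI, clarify)
    fix b a assume d: "(b, a) \<in> D"
    then have "\<bar>g 0 [:b, a:] - x [:b, a:]\<bar> < e" "\<bar>g 1 [:b, a:] - x [:b, a:]\<bar> < e"
      using ends by (auto simp: nbhd_def)
    then show "\<bar>g t [:b, a:] - x [:b, a:]\<bar> < e"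
      using between[of a b t] d D t unfolding abs_less_iff min_le_iff_disj le_max_iff_disj by force
  qed
  moreover have "continuous_map (top_of_set {0..1}) X g"
    using cont by (intro continuous_map_into_line) (auto simp: g)
  ultimately have "pathin (subtopology X (nbhd x D e)) g"
    unfolding pathin_def by (auto simp: continuous_map_in_subtopology)
  then show ?thesis unfolding path_component_of_def by blast
qed

section \<open>Thickenings, discs and powers\<close>

lemma restrict_pts:
  assumes \<phi>: "nonarch_seminorm PR \<phi>" and "\<And>a. a \<in> R \<Longrightarrow> \<phi> [:a:] \<le> N a"
  shows "restrict \<phi> PR \<in> pts"
proof -
  interpret nonarch_seminorm PR \<phi> by fact
  have "nonarch_seminorm PR (restrict \<phi> PR)"
    by unfold_locales (auto simp: subring_PR zero one nonneg mult ultra PR_closed)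
  then show ?thesis using assms by (simp add: affine_line_set_iff)
qed

text \<open>The supremum over the disc of radius \<open>r\<close> around the point \<open>y\<close>: the Gauss norm of \<open>p (t + u)\<close> as a
  polynomial in \<open>u\<close>. Gauss's lemma shows that it is multiplicative, so this is the flow that
  moves points upwards in the tree structure of a fibre.\<close>
definition thicken :: "('k poly \<Rightarrow> real) \<Rightarrow> real \<Rightarrow> 'k poly \<Rightarrow> real" where
  "thicken y r = restrict (\<lambda>p. gauss_norm y r (taylor p)) PR"

lemma thicken_linear:
  assumes y: "y \<in> pts" "0 \<le> r" "a \<in> R" "b \<in> R"
  shows "thicken y r [:b, a:] = max (y [:b, a:]) (y [:a:] * r)"
  using nonarch_seminorm.gauss_norm_linear[OF pts_nonarch[OF y(1)], of "[:a:]" "[:b, a:]" r] assms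
  by (simp add: thicken_def taylor_linear)

lemma thicken_pts:
  assumes y: "y \<in> pts" "0 \<le> r" shows "thicken y r \<in> pts"
  unfolding thicken_def
proof (rule restrict_pts)
  interpret nonarch_seminorm PR y by (rule pts_nonarch[OF y(1)])
  interpret G: nonarch_seminorm "polys_over PR" "gauss_norm y r" by (rule nonarch_gauss_norm[OF y(2)])
  show "nonarch_seminorm PR (\<lambda>p. gauss_norm y r (taylor p))"
    by (rule G.comp_hom[OF subring_PR])
      (auto simp: taylor_add taylor_mult taylor_mem[OF subring_R] taylor_const one_pCons)
  show "gauss_norm y r (taylor [:a:]) \<le> N a" if "a \<in> R" for a
    using pts_contractive[OF y(1) that] by (simp add: taylor_const)
qed

lemma thicken_0:
  assumes y: "y \<in> pts" shows "thicken y 0 = y"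
  using thicken_pts[OF y] y
  by (intro pts_eqI) (auto simp: thicken_linear pts_nonneg)

lemma poly_in_R: "p \<in> PR \<Longrightarrow> a \<in> R \<Longrightarrow> poly p a \<in> R"
  unfolding poly_altdef
  by (intro subring_sum[OF subring_R] R_closed(6) subring_power[OF subring_R]) (auto simp: polys_over_def)

text \<open>The classical point \<open>t = a\<close>, with constants measured by \<open>const_norm \<sigma>\<close>.\<close>
definition eval_pt :: "'k \<Rightarrow> real \<Rightarrow> 'k poly \<Rightarrow> real" where
  "eval_pt a \<sigma> = restrict (\<lambda>p. const_norm \<sigma> (poly p a)) PR"

lemma eval_pt_pts:
  assumes "a \<in> R" "0 \<le> \<sigma>" "\<sigma> \<le> N c" shows "eval_pt a \<sigma> \<in> pts"
  unfolding eval_pt_def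
  using assms
  by (intro restrict_pts nonarch_seminorm.comp_hom[OF const_norm_seminorm] subring_PR)
    (auto simp: poly_in_R const_norm_le_N)

text \<open>The Gauss point of the disc of radius \<open>r\<close> around \<open>a\<close>.\<close>
definition disc_pt :: "'k \<Rightarrow> real \<Rightarrow> real \<Rightarrow> 'k poly \<Rightarrow> real" where
  "disc_pt a \<sigma> r = thicken (eval_pt a \<sigma>) r"

lemma disc_pt_pts:
  assumes "a \<in> R" "0 \<le> \<sigma>" "\<sigma> \<le> N c" "0 \<le> r" shows "disc_pt a \<sigma> r \<in> pts"
  unfolding disc_pt_def by (intro thicken_pts eval_pt_pts assms)

lemma disc_pt_linear:
  assumes "a \<in> R" "0 \<le> \<sigma>" "\<sigma> \<le> N c" "0 \<le> r" "\<alpha> \<in> R" "\<beta> \<in> R"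
  shows "disc_pt a \<sigma> r [:\<beta>, \<alpha>:] = max (const_norm \<sigma> (\<beta> + \<alpha> * a)) (const_norm \<sigma> \<alpha> * r)"
  unfolding disc_pt_def using assms
  by (simp add: thicken_linear eval_pt_pts) (simp add: eval_pt_def mult.commute)

text \<open>Enlarging \<open>y\<close> by its distance from \<open>a\<close> swallows the point \<open>a\<close>, and all that remains of \<open>y\<close> is the
  disc and the norm on constants.\<close>
lemma thicken_eq_disc:
  assumes y: "y \<in> pts" and a0: "a0 \<in> R"
  shows "thicken y (y [:- a0, 1:]) = disc_pt a0 (y [:c:]) (y [:- a0, 1:])"
proof -
  interpret nonarch_seminorm PR y by (rule pts_nonarch[OF y])
  have l: "[:- a0, 1:] \<in> PR" using a0 R_closed by simp
  have nn: "0 \<le> y [:- a0, 1:]" by (rule nonneg[OF l])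
  show ?thesis
  proof (rule pts_eqI)
    show "thicken y (y [:- a0, 1:]) \<in> pts" "disc_pt a0 (y [:c:]) (y [:- a0, 1:]) \<in> pts"
      using y a0 nn pts_c[OF y] by (auto intro: thicken_pts disc_pt_pts)
    fix a b assume ab: "a \<in> R" "b \<in> R"
    then have d: "b + a * a0 \<in> R" using a0 by (intro R_closed)
    have eq: "[:b, a:] = [:a:] * [:- a0, 1:] + [:b + a * a0:]" by simp
    have "[:a:] * [:- a0, 1:] \<in> PR" "[:b + a * a0:] \<in> PR"
      using ab d l by (simp_all only: PR_closed lin_PR)
    from max_add_left[OF this]
    have "max (y [:b, a:]) (y ([:a:] * [:- a0, 1:])) = max (y ([:a:] * [:- a0, 1:])) (y [:b + a * a0:])"
      by (simp only: eq[symmetric])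
    then show "thicken y (y [:- a0, 1:]) [:b, a:] = disc_pt a0 (y [:c:]) (y [:- a0, 1:]) [:b, a:]"
      using ab d y a0 nn pts_c[OF y] mult[of "[:a:]" "[:- a0, 1:]"] l
      by (simp add: thicken_linear disc_pt_linear max.commute flip: pts_const[OF y])
  qed
qed

text \<open>Taking powers moves points between the fibres with \<open>\<sigma> > 0\<close>.\<close>
definition power_pt :: "('k poly \<Rightarrow> real) \<Rightarrow> real \<Rightarrow> 'k poly \<Rightarrow> real" where
  "power_pt y k = restrict (\<lambda>p. y p powr k) PR"

text \<open>The bound on the value at \<open>c\<close> is what contractivity on \<open>R\<close> amounts to.\<close>
lemma power_pt_pts:
  assumes y: "y \<in> pts" "0 < k" "y [:c:] powr k \<le> N c" shows "power_pt y k \<in> pts"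
  unfolding power_pt_def
proof (rule restrict_pts[OF power_seminorm[OF pts_nonarch[OF y(1)] y(2)]])
  fix a assume a: "a \<in> R"
  have "y [:a:] powr k = const_norm (y [:c:] powr k) a"
    using pts_const[OF y(1) a] const_norm_powr[OF a pts_c(1)[OF y(1)]] by simp
  also have "\<dots> \<le> N a" using a y(3) by (intro const_norm_le_N) auto
  finally show "y [:a:] powr k \<le> N a" .
qed

lemma power_pt_apply: "p \<in> PR \<Longrightarrow> power_pt y k p = y p powr k"
  by (simp add: power_pt_def)

section \<open>Monotone paths\<close>

text \<open>The coordinate at \<open>a t + b\<close> is \<open>max (y [:b, a:]) (y [:a:] * r)\<close>, which increases with \<open>r\<close>.\<close>
lemma thicken_path:
  assumes r: "0 \<le> r" and D: "D \<subseteq> R \<times> R"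
    and y: "y \<in> nbhd x D e" "thicken y r \<in> nbhd x D e"
  shows "path_component_of (subtopology X (nbhd x D e)) y (thicken y r)"
proof -
  have yp: "y \<in> pts" using y nbhd_subset by blast
  define g where "g t = thicken y (t * r)" for t
  have lin: "g t [:b, a:] = max (y [:b, a:]) (y [:a:] * (t * r))" if "a \<in> R" "b \<in> R" "t \<in> {0..1}" for a b t
    using that r by (simp add: g_def thicken_linear yp)
  have "path_component_of (subtopology X (nbhd x D e)) (g 0) (g 1)"
  proof (rule path_in_nbhd)
    show "g t \<in> pts" if "t \<in> {0..1}" for t using that r by (simp add: g_def thicken_pts yp)
    fix a b assume ab: "a \<in> R" "b \<in> R"
    have "continuous_on {0..1} (\<lambda>t. max (y [:b, a:]) (y [:a:] * (t * r)))"
      by (intro continuous_intros)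
    then show "continuous_on {0..1} (\<lambda>t. g t [:b, a:])"
      by (rule continuous_on_eq) (simp add: lin ab)
    fix t :: real assume t: "t \<in> {0..1}"
    have "0 \<le> y [:a:] * (t * r)" "y [:a:] * (t * r) \<le> y [:a:] * r"
      using t r pts_nonneg[OF yp] ab by (auto intro!: mult_left_mono simp: mult_left_le_one_le)
    then show "min (g 0 [:b, a:]) (g 1 [:b, a:]) \<le> g t [:b, a:] \<and> g t [:b, a:] \<le> max (g 0 [:b, a:]) (g 1 [:b, a:])"
      using t by (auto simp: lin ab min_def max_def)
  qed (use D y in \<open>auto simp: g_def thicken_0 yp\<close>)
  then show ?thesis by (simp add: g_def thicken_0 yp)
qed

text \<open>The exponent \<open>1 + t * (k - 1)\<close> lies between 1 and \<open>k\<close>.\<close>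
lemma powr_between:
  fixes v k t :: real
  assumes "0 \<le> v" "0 \<le> t" "t \<le> 1"
  shows "min v (v powr k) \<le> v powr (1 + t * (k - 1)) \<and> v powr (1 + t * (k - 1)) \<le> max v (v powr k)"
proof (cases "v = 0")
  case False
  then have v: "0 < v" using assms by simp
  let ?l = "1 + t * (k - 1)"
  have "(1 \<le> ?l \<and> ?l \<le> k) \<or> (k \<le> ?l \<and> ?l \<le> 1)"
  proof (cases "1 \<le> k")
    case True
    then have "0 \<le> t * (k - 1)" "t * (k - 1) \<le> k - 1" using assms by (auto simp: mult_left_le_one_le)
    then show ?thesis by simp
  next
    case False
    then have "0 \<le> t * (1 - k)" "t * (1 - k) \<le> 1 - k" using assms by (auto simp: mult_left_le_one_le)
    then show ?thesis by (simp add: algebra_simps)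
  qed
  moreover have v1: "v powr 1 = v" using v by simp
  moreover have "v powr i \<le> v powr j" if "v \<ge> 1 \<and> i \<le> j \<or> v < 1 \<and> j \<le> i" for i j
    using that v by (auto intro: powr_mono powr_mono')
  ultimately show ?thesis
    by (metis linorder_not_less max.coboundedI1 max.coboundedI2 min.coboundedI1 min.coboundedI2)
qed simp

text \<open>A power \<open>v powr k\<close> is monotone in its exponent; the direction depends on whether \<open>v\<close> exceeds 1,
  and so differs between coordinates.\<close>
lemma power_path:
  assumes k: "0 < k" and c: "y [:c:] powr k \<le> N c" and D: "D \<subseteq> R \<times> R"
    and y: "y \<in> nbhd x D e" "power_pt y k \<in> nbhd x D e"
  shows "path_component_of (subtopology X (nbhd x D e)) y (power_pt y k)"
proof -
  have yp: "y \<in> pts" using y nbhd_subset by blast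
  define g where "g t = power_pt y (1 + t * (k - 1))" for t
  have pos: "0 < 1 + t * (k - 1)" if "t \<in> {0..1}" for t
  proof -
    have "1 + t * (k - 1) = (1 - t) + t * k" by (simp add: algebra_simps)
    moreover have "0 < (1 - t) + t * k"
      using that k by (cases "t = 1") (simp_all add: add_pos_nonneg)
    ultimately show ?thesis by simp
  qed
  have gp: "g t \<in> pts" if "t \<in> {0..1}" for t
    unfolding g_def
  proof (rule power_pt_pts[OF yp pos[OF that]])
    show "y [:c:] powr (1 + t * (k - 1)) \<le> N c"
      using powr_between[of "y [:c:]" t k] that pts_c[OF yp] c by auto
  qed
  have lin: "g t [:b, a:] = y [:b, a:] powr (1 + t * (k - 1))" if "a \<in> R" "b \<in> R" for a b t
    using that by (simp add: g_def power_pt_apply)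
  \<comment> \<open>The exponent runs linearly from 1 to \<open>k\<close>.\<close>
  have g0: "g 0 = y"
    using gp[of 0] yp lin pts_nonneg[OF yp] by (intro pts_eqI) auto
  have g1: "g 1 = power_pt y k" by (simp add: g_def)
  have "path_component_of (subtopology X (nbhd x D e)) (g 0) (g 1)"
  proof (rule path_in_nbhd[OF gp])
    fix a b assume ab: "a \<in> R" "b \<in> R"
    then have nn: "0 \<le> y [:b, a:]" by (intro pts_nonneg yp) simp
    have "continuous_on {0..1} (\<lambda>t. y [:b, a:] powr (1 + t * (k - 1)))"
      by (intro continuous_on_powr' continuous_intros) (auto simp: nn pos)
    then show "continuous_on {0..1} (\<lambda>t. g t [:b, a:])" by (simp add: lin ab)
    fix t :: real assume t: "t \<in> {0..1}"
    then show "min (g 0 [:b, a:]) (g 1 [:b, a:]) \<le> g t [:b, a:] \<and> g t [:b, a:] \<le> max (g 0 [:b, a:]) (g 1 [:b, a:])"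
      using powr_between[OF nn, of t k] by (simp add: lin ab nn)
  qed (use D y in \<open>auto simp: g0 g1\<close>)
  then show ?thesis by (simp add: g0 g1)
qed

text \<open>The coordinates of \<open>disc_pt\<close> increase with the radius and with \<open>\<sigma>\<close>. As \<open>\<sigma> = 0\<close> is admitted, these
  paths connect the generic fibres with the residue fibre.\<close>
lemma disc_path:
  assumes a0: "a0 \<in> R" and \<sigma>: "0 \<le> \<sigma>" "\<sigma> \<le> \<tau>" "\<tau> \<le> N c" and r: "0 \<le> r" "r \<le> s"
    and D: "D \<subseteq> R \<times> R"
    and y: "disc_pt a0 \<sigma> r \<in> nbhd x D e" "disc_pt a0 \<tau> s \<in> nbhd x D e"
  shows "path_component_of (subtopology X (nbhd x D e)) (disc_pt a0 \<sigma> r) (disc_pt a0 \<tau> s)"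
proof -
  define \<rho> where "\<rho> t = \<sigma> + t * (\<tau> - \<sigma>)" for t
  define q where "q t = r + t * (s - r)" for t
  define g where "g t = disc_pt a0 (\<rho> t) (q t)" for t
  have \<rho>: "\<sigma> \<le> \<rho> t" "\<rho> t \<le> \<tau>" and q: "r \<le> q t" "q t \<le> s" if "t \<in> {0..1}" for t
    using that \<sigma> r mult_left_le_one_le[of "\<tau> - \<sigma>" t] mult_left_le_one_le[of "s - r" t]
    by (auto simp: \<rho>_def q_def)
  have lin: "g t [:b, a:] = max (const_norm (\<rho> t) (b + a * a0)) (const_norm (\<rho> t) a * q t)"
    if "a \<in> R" "b \<in> R" "t \<in> {0..1}" for a b t
    unfolding g_def using \<rho>[OF that(3)] q[OF that(3)] that a0 \<sigma> r
    by (intro disc_pt_linear) auto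
  have "path_component_of (subtopology X (nbhd x D e)) (g 0) (g 1)"
  proof (rule path_in_nbhd)
    show "g t \<in> pts" if "t \<in> {0..1}" for t
      unfolding g_def using \<rho>[OF that] q[OF that] that a0 \<sigma> r by (intro disc_pt_pts) auto
    fix a b assume ab: "a \<in> R" "b \<in> R"
    then have d: "b + a * a0 \<in> R" using a0 by (intro R_closed)
    have cont: "continuous_on {0..1} (\<lambda>t. const_norm (\<rho> t) d)" if "d \<in> R" for d
    proof (rule continuous_on_compose2[OF continuous_on_const_norm[OF that]])
      show "continuous_on {0..1} \<rho>" unfolding \<rho>_def by (intro continuous_intros)
      show "\<rho> ` {0..1} \<subseteq> {0..}" using \<rho>(1) \<sigma> by force
    qed
    have "continuous_on {0..1} q" unfolding q_def by (intro continuous_intros)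
    then have "continuous_on {0..1} (\<lambda>t. max (const_norm (\<rho> t) (b + a * a0)) (const_norm (\<rho> t) a * q t))"
      by (intro continuous_on_max continuous_on_mult cont d ab)
    then show "continuous_on {0..1} (\<lambda>t. g t [:b, a:])"
      by (rule continuous_on_eq) (simp add: lin ab)
    fix t :: real assume t: "t \<in> {0..1}"
    have mono: "g t [:b, a:] \<le> g t' [:b, a:]" if "t \<in> {0..1}" "t' \<in> {0..1}" "t \<le> t'" for t t'
    proof -
      have le: "\<rho> t \<le> \<rho> t'" "q t \<le> q t'"
        using that \<sigma> r by (auto simp: \<rho>_def q_def intro!: mult_right_mono)
      have "const_norm (\<rho> t) d \<le> const_norm (\<rho> t') d" if "d \<in> R" for d
        using \<rho>[OF \<open>t \<in> {0..1}\<close>] \<sigma> le by (intro const_norm_mono that) auto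
      then show ?thesis
        unfolding lin[OF ab that(1)] lin[OF ab that(2)]
        using ab d le q[OF \<open>t \<in> {0..1}\<close>] r
        by (intro max.mono mult_mono) (auto simp: const_norm_nonneg)
    qed
    show "min (g 0 [:b, a:]) (g 1 [:b, a:]) \<le> g t [:b, a:] \<and> g t [:b, a:] \<le> max (g 0 [:b, a:]) (g 1 [:b, a:])"
      using mono[of 0 t] mono[of t 1] t by auto
  qed (use D y in \<open>auto simp: g_def \<rho>_def q_def\<close>)
  then show ?thesis by (simp add: g_def \<rho>_def q_def)
qed

text \<open>Thicken \<open>y\<close> until it becomes a disc around \<open>a\<close>, let \<open>\<sigma>\<close> go to 0 with the disc fixed, and then
  adjust the radius.\<close>
lemma path_to_residue_disc:
  assumes a0: "a0 \<in> R" and \<rho>: "0 \<le> \<rho>" and D: "D \<subseteq> R \<times> R"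
    and "y \<in> nbhd x D e" "thicken y (y [:- a0, 1:]) \<in> nbhd x D e"
      "disc_pt a0 0 (y [:- a0, 1:]) \<in> nbhd x D e" "disc_pt a0 0 \<rho> \<in> nbhd x D e"
  shows "path_component_of (subtopology X (nbhd x D e)) y (disc_pt a0 0 \<rho>)"
proof -
  let ?T = "subtopology X (nbhd x D e)" and ?r = "y [:- a0, 1:]"
  have yp: "y \<in> pts" using assms nbhd_subset by blast
  have r: "0 \<le> ?r" using a0 R_closed by (intro pts_nonneg yp) simp
  have "path_component_of ?T y (thicken y ?r)"
    using r D assms by (intro thicken_path) auto
  moreover have "path_component_of ?T (disc_pt a0 0 ?r) (thicken y ?r)"
    using r D assms pts_c[OF yp] by (auto simp: thicken_eq_disc yp intro!: disc_path)
  moreover have "path_component_of ?T (disc_pt a0 0 ?r) (disc_pt a0 0 \<rho>)"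
  proof (cases "?r \<le> \<rho>")
    case True
    then show ?thesis using r D assms c_pos by (intro disc_path) auto
  next
    case False
    then show ?thesis using \<rho> D assms c_pos
      by (intro path_component_of_sym[OF disc_path]) auto
  qed
  ultimately show ?thesis by (meson path_component_of_sym path_component_of_trans)
qed

text \<open>Without conditions on the coordinates, the path of \<open>path_to_residue_disc\<close> joins every
  point to the point \<open>t = 0\<close> of the residue fibre.\<close>
theorem path_connected_line: "path_connected_space X"
proof -
  have "path_component_of X y (disc_pt 0 0 0)" if y: "y \<in> pts" for y
  proof -
    have r: "0 \<le> y [:- 0, 1:]" using R_closed by (intro pts_nonneg y) simp
    have "nbhd y {} 1 = pts" by (auto simp: nbhd_def)
    then show ?thesis
      using path_to_residue_disc[of 0 0 "{}" y y 1] y r c_pos R_closed(1)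
      by (simp add: thicken_pts disc_pt_pts subtopology_superset)
  qed
  then show ?thesis
    unfolding path_connected_space_iff_path_component topspace_X
    by (meson path_component_of_sym path_component_of_trans)
qed

end

section \<open>Joins within a fibre\<close>

text \<open>The inequality behind the join of two points of a fibre: \<open>X\<close> and \<open>Y\<close> are two seminorms of a
  sum, whose terms have the seminorms \<open>P\<close> and \<open>g\<close>, respectively \<open>Q\<close> and \<open>g\<close>.\<close>
lemma max_join:
  fixes P Q g X Y :: real
  assumes "X \<le> max P g" "P \<noteq> g \<Longrightarrow> X = max P g" "Y \<le> max Q g" "Q \<noteq> g \<Longrightarrow> Y = max Q g"
    "0 \<le> X" "0 \<le> Y" "0 \<le> g" "0 \<le> P" "P < Q \<or> P = 0 \<and> Q = 0"
  shows "max X Q = max X Y \<and> max Y Q = max X Y"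
proof -
  consider "g < Q" | "g = Q" "P < Q" | "g = Q" "P = 0" "Q = 0" | "Q < g" using assms(9) by linarith
  then show ?thesis
  proof cases
    case 1
    then have "Y = Q" "X \<le> Q" using assms by auto
    then show ?thesis by simp
  next
    case 2
    then have "X = Q" "Y \<le> Q" using assms by auto
    then show ?thesis by simp
  next
    case 3
    then have "X = 0" "Y = 0" using assms by auto
    then show ?thesis using 3 by simp
  next
    case 4
    then have "X = g" "Y = g" using assms by auto
    then show ?thesis using 4 by simp
  qed
qed

context valued_line
begin

text \<open>Let \<open>x\<close> and \<open>y\<close> agree on constants and let \<open>x < y\<close> at \<open>l = a0 t + b0\<close>. Thickening both by \<open>r\<close>, which
  raises the value at \<open>l\<close> to \<open>y l\<close>, produces one and the same point, whose coordinates are the maxima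
  of those of \<open>x\<close> and \<open>y\<close>. The reason is that any other \<open>a t + b\<close> satisfies
  \<open>a0 (a t + b) = a l + const\<close>, so both of its values are governed by the values at \<open>l\<close> and by a common
  constant; \<open>max_join\<close> settles the cases.\<close>
lemma fibre_join:
  assumes x: "x \<in> pts" and y: "y \<in> pts" and c: "x [:c:] = y [:c:]"
    and ab0: "a0 \<in> R" "b0 \<in> R" and less: "x [:b0, a0:] < y [:b0, a0:]"
    and ab: "a \<in> R" "b \<in> R"
  defines "r \<equiv> y [:b0, a0:] / x [:a0:]"
  shows "max (x [:b, a:]) (x [:a:] * r) = max (x [:b, a:]) (y [:b, a:])"
    and "max (y [:b, a:]) (x [:a:] * r) = max (x [:b, a:]) (y [:b, a:])"
    and "0 \<le> r"
proof -
  interpret x: nonarch_seminorm PR x by (rule pts_nonarch[OF x])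
  interpret y: nonarch_seminorm PR y by (rule pts_nonarch[OF y])
  have const: "y [:d:] = x [:d:]" if "d \<in> R" for d
    using pts_const[OF x that] pts_const[OF y that] c by simp
  have nn: "0 \<le> x [:a0:]" "0 \<le> x [:a:]" "0 \<le> x [:b0, a0:]" using ab ab0 x.nonneg by auto
  \<comment> \<open>Otherwise \<open>a0 t\<close> has value 0 and both points take the value of the constant \<open>b0\<close> at \<open>a0 t + b0\<close>.\<close>
  have A0: "0 < x [:a0:]"
  proof (rule ccontr)
    assume "\<not> 0 < x [:a0:]"
    then have z: "x [:a0:] = 0" using nn by simp
    have t: "[:0, 1:] \<in> PR" "[:a0:] \<in> PR" "[:b0:] \<in> PR" using R_closed ab0 by auto
    have e: "[:b0, a0:] = [:a0:] * [:0, 1:] + [:b0:]" by simp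
    have m: "[:a0:] * [:0, 1:] \<in> PR" by (intro PR_closed t)
    have "x [:b0, a0:] = x [:b0:]"
    proof -
      have "x ([:a0:] * [:0, 1:]) = 0" using x.mult[OF t(2,1)] z by simp
      then show ?thesis
        using x.add_eq_max[OF m t(3)] x.ultra[OF m t(3)] x.nonneg[OF t(3)] x.nonneg[of "[:b0, a0:]"] ab0
        unfolding e[symmetric] by (cases "x [:b0:] = 0") auto
    qed
    moreover have "y [:b0, a0:] = y [:b0:]"
    proof -
      have "y ([:a0:] * [:0, 1:]) = 0" using y.mult[OF t(2,1)] z const[OF ab0(1)] by simp
      then show ?thesis
        using y.add_eq_max[OF m t(3)] y.ultra[OF m t(3)] y.nonneg[OF t(3)] y.nonneg[of "[:b0, a0:]"] ab0
        unfolding e[symmetric] by (cases "y [:b0:] = 0") auto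
    qed
    ultimately show False using less const[OF ab0(2)] by simp
  qed
  \<comment> \<open>The constant in \<open>a0 (a t + b) = a (a0 t + b0) + d\<close>.\<close>
  define d where "d = a0 * b - a * b0"
  have d: "d \<in> R" unfolding d_def using ab ab0 by (intro R_closed)
  have eq: "[:a0:] * [:b, a:] = [:a:] * [:b0, a0:] + [:d:]" by (simp add: d_def)
  have mem: "[:a0:] \<in> PR" "[:b, a:] \<in> PR" "[:a:] \<in> PR" "[:b0, a0:] \<in> PR" "[:d:] \<in> PR"
      "[:a:] * [:b0, a0:] \<in> PR"
    using ab ab0 d by (simp_all only: lin_PR PR_closed)
  define P Q g where "P = x [:a:] * x [:b0, a0:]" and "Q = x [:a:] * y [:b0, a0:]" and "g = x [:d:]"
  have Px: "P = x ([:a:] * [:b0, a0:])" unfolding P_def by (rule x.mult[OF mem(3,4), symmetric])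
  have Qy: "Q = y ([:a:] * [:b0, a0:])"
    unfolding Q_def const[OF ab(1), symmetric] by (rule y.mult[OF mem(3,4), symmetric])
  have X: "x [:a0:] * x [:b, a:] = x ([:a:] * [:b0, a0:] + [:d:])"
    unfolding eq[symmetric] by (rule x.mult[OF mem(1,2), symmetric])
  have Y: "x [:a0:] * y [:b, a:] = y ([:a:] * [:b0, a0:] + [:d:])"
    unfolding eq[symmetric] const[OF ab0(1), symmetric] by (rule y.mult[OF mem(1,2), symmetric])
  have 1: "x [:a0:] * x [:b, a:] \<le> max P g" "P \<noteq> g \<Longrightarrow> x [:a0:] * x [:b, a:] = max P g"
    unfolding X Px g_def using x.ultra[OF mem(6,5)] x.add_eq_max[OF mem(6,5)] by auto
  have 2: "x [:a0:] * y [:b, a:] \<le> max Q g" "Q \<noteq> g \<Longrightarrow> x [:a0:] * y [:b, a:] = max Q g"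
    unfolding Y Qy g_def const[OF d, symmetric] using y.ultra[OF mem(6,5)] y.add_eq_max[OF mem(6,5)] by auto
  have 3: "0 \<le> x [:a0:] * x [:b, a:]" "0 \<le> x [:a0:] * y [:b, a:]" "0 \<le> g" "0 \<le> P"
    using nn x.nonneg[OF mem(2)] y.nonneg[OF mem(2)] x.nonneg[OF mem(5)]
    by (simp_all add: g_def P_def)
  have 4: "P < Q \<or> P = 0 \<and> Q = 0"
    using nn less by (cases "x [:a:] = 0") (auto simp: P_def Q_def)
  have main: "max (x [:a0:] * x [:b, a:]) Q = max (x [:a0:] * x [:b, a:]) (x [:a0:] * y [:b, a:])"
    "max (x [:a0:] * y [:b, a:]) Q = max (x [:a0:] * x [:b, a:]) (x [:a0:] * y [:b, a:])"
    using max_join[OF 1 2 3 4] by auto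
  have rQ: "x [:a0:] * (x [:a:] * r) = Q" using A0 by (simp add: r_def Q_def)
  have mm: "x [:a0:] * max u v = max (x [:a0:] * u) (x [:a0:] * v)" for u v
    using A0 by (simp add: max_mult_distrib_left)
  have inj: "u = v" if "x [:a0:] * u = x [:a0:] * v" for u v using that A0 by simp
  show "max (x [:b, a:]) (x [:a:] * r) = max (x [:b, a:]) (y [:b, a:])"
    by (rule inj) (simp only: mm rQ main)
  show "max (y [:b, a:]) (x [:a:] * r) = max (x [:b, a:]) (y [:b, a:])"
    by (rule inj) (simp only: mm rQ main)
  show "0 \<le> r" using A0 less nn by (simp add: r_def)
qed

lemma fibre_path_of_less:
  assumes x: "x \<in> nbhd z D e" and y: "y \<in> nbhd z D e" and c: "x [:c:] = y [:c:]" and D: "D \<subseteq> R \<times> R"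
    and ab0: "a0 \<in> R" "b0 \<in> R" and less: "x [:b0, a0:] < y [:b0, a0:]"
  shows "path_component_of (subtopology X (nbhd z D e)) x y"
proof -
  have xp: "x \<in> pts" and yp: "y \<in> pts" using x y nbhd_subset by auto
  define r where "r = y [:b0, a0:] / x [:a0:]"
  note J = fibre_join[OF xp yp c ab0 less, folded r_def]
  have r: "0 \<le> r" using J(3)[OF ab0] .
  have const: "y [:d:] = x [:d:]" if "d \<in> R" for d
    using pts_const[OF xp that] pts_const[OF yp that] c by simp
  have lx: "thicken x r [:b, a:] = max (x [:b, a:]) (y [:b, a:])"
    and ly: "thicken y r [:b, a:] = max (x [:b, a:]) (y [:b, a:])" if "a \<in> R" "b \<in> R" for a b
    using J(1,2)[OF that] that r xp yp by (simp_all add: thicken_linear const)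
  have eq: "thicken x r = thicken y r"
    using r xp yp by (intro pts_eqI) (auto simp: thicken_pts lx ly)
  have m: "thicken x r \<in> nbhd z D e"
    unfolding nbhd_def
  proof (intro CollectI conjI ballI, goal_cases)
    case 1 then show ?case by (rule thicken_pts[OF xp r])
  next
    case (2 p)
    then obtain b a where p: "p = (b, a)" "a \<in> R" "b \<in> R" "(b, a) \<in> D" using D by (cases p) auto
    then have "\<bar>x [:b, a:] - z [:b, a:]\<bar> < e" "\<bar>y [:b, a:] - z [:b, a:]\<bar> < e"
      using x y by (auto simp: nbhd_def)
    then show ?case using p by (simp add: lx max_def)
  qed
  have "path_component_of (subtopology X (nbhd z D e)) x (thicken x r)"
    by (rule thicken_path[OF r D x m])
  moreover have "path_component_of (subtopology X (nbhd z D e)) y (thicken y r)"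
    by (rule thicken_path[OF r D y m[unfolded eq]])
  ultimately show ?thesis unfolding eq by (meson path_component_of_sym path_component_of_trans)
qed

text \<open>Move from \<open>x\<close> up to the join of \<open>x\<close> and \<open>y\<close> and down to \<open>y\<close>. The join lies in the neighbourhood
  since its coordinates are coordinates of \<open>x\<close> or of \<open>y\<close>.\<close>
lemma fibre_path:
  assumes x: "x \<in> nbhd z D e" and y: "y \<in> nbhd z D e" and c: "x [:c:] = y [:c:]" and D: "D \<subseteq> R \<times> R"
  shows "path_component_of (subtopology X (nbhd z D e)) x y"
proof (cases "x = y")
  case True
  then show ?thesis using x nbhd_subset by (auto simp: path_component_of_refl)
next
  case False
  have "x \<in> pts" "y \<in> pts" using x y nbhd_subset by auto
  then obtain a0 b0 where ab0: "a0 \<in> R" "b0 \<in> R" "x [:b0, a0:] \<noteq> y [:b0, a0:]"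
    using False pts_eqI by metis
  then consider "x [:b0, a0:] < y [:b0, a0:]" | "y [:b0, a0:] < x [:b0, a0:]" by linarith
  then show ?thesis
  proof cases
    case 1
    then show ?thesis using fibre_path_of_less[OF x y c D ab0(1,2)] by simp
  next
    case 2
    then show ?thesis using path_component_of_sym[OF fibre_path_of_less[OF y x c[symmetric] D ab0(1,2)]] by simp
  qed
qed

end

section \<open>Local path connectedness\<close>

lemma continuous_map_real_ln:
  assumes "continuous_map X euclideanreal f" "\<And>x. x \<in> topspace X \<Longrightarrow> 0 < f x"
  shows "continuous_map X euclideanreal (\<lambda>x. ln (f x))"
  unfolding continuous_map_atin limitin_canonical_iff
proof
  fix x assume x: "x \<in> topspace X"
  then have "(f \<longlongrightarrow> f x) (atin X x)"
    using assms(1) by (simp add: continuous_map_atin)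
  then show "((\<lambda>x. ln (f x)) \<longlongrightarrow> ln (f x)) (atin X x)"
    by (rule tendsto_ln) (use assms(2)[OF x] in simp)
qed

lemma continuous_map_real_powr:
  assumes "continuous_map X euclideanreal f" "continuous_map X euclideanreal g"
    and "\<And>x. x \<in> topspace X \<Longrightarrow> 0 \<le> f x" "\<And>x. x \<in> topspace X \<Longrightarrow> 0 < g x"
  shows "continuous_map X euclideanreal (\<lambda>x. f x powr g x)"
  unfolding continuous_map_atin limitin_canonical_iff
proof
  fix x assume x: "x \<in> topspace X"
  have ev: "eventually (\<lambda>z. 0 \<le> f z) (atin X x)"
    unfolding eventually_atin using assms(3) by blast
  show "((\<lambda>z. f z powr g z) \<longlongrightarrow> f x powr g x) (atin X x)"
    using assms(1,2) x assms(4)[OF x] ev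
    by (intro tendsto_powr') (auto simp: continuous_map_atin)
qed

context valued_line
begin

text \<open>Over a trivially valued field every point is a disc: values \<open>x (t - a) < 1\<close> occur for at most one
  residue class, and if there is one, it contains the centre. Otherwise all \<open>t - a\<close> have value at least
  1, and any centre will do.\<close>
lemma residue_point_is_disc:
  assumes x: "x \<in> pts" and c: "x [:c:] = 0"
  obtains a0 where "a0 \<in> R" "x = disc_pt a0 0 (x [:- a0, 1:])"
proof -
  interpret nonarch_seminorm PR x by (rule pts_nonarch[OF x])
  have const: "x [:a:] = const_norm 0 a" if "a \<in> R" for a
    using pts_const[OF x that] c by simp
  \<comment> \<open>If all \<open>t - a\<close> have value at least 1, the centre is 0.\<close>
  obtain a0 where a0: "a0 \<in> R" and min: "x [:- a0, 1:] < 1 \<or> (\<forall>a\<in>R. 1 \<le> x [:- a, 1:])"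
    using R_closed(1) by (metis not_less)
  let ?\<rho> = "x [:- a0, 1:]"
  have l: "[:- a0, 1:] \<in> PR" using a0 R_closed by simp
  have \<rho>: "0 \<le> ?\<rho>" by (rule nonneg[OF l])
  have "x = disc_pt a0 0 ?\<rho>"
  proof (rule pts_eqI[OF x])
    show "disc_pt a0 0 ?\<rho> \<in> pts" using a0 \<rho> c_pos by (intro disc_pt_pts) auto
    fix a b assume ab: "a \<in> R" "b \<in> R"
    then have d: "b + a * a0 \<in> R" using a0 by (intro R_closed)
    have eq: "[:b, a:] = [:a:] * [:- a0, 1:] + [:b + a * a0:]" by simp
    have mem: "[:a:] \<in> PR" "[:a:] * [:- a0, 1:] \<in> PR" "[:b + a * a0:] \<in> PR" "[:b, a:] \<in> PR"
      using ab d l by (simp_all only: PR_closed lin_PR)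
    have m: "x ([:a:] * [:- a0, 1:]) = const_norm 0 a * ?\<rho>"
      using mult[OF mem(1) l] const[OF ab(1)] by simp
    have le: "x [:b, a:] \<le> max (const_norm 0 a * ?\<rho>) (const_norm 0 (b + a * a0))"
      using ultra[OF mem(2,3)] unfolding eq[symmetric] m const[OF d] .
    have ne: "x [:b, a:] = max (const_norm 0 a * ?\<rho>) (const_norm 0 (b + a * a0))"
      if "const_norm 0 a * ?\<rho> \<noteq> const_norm 0 (b + a * a0)"
      using add_eq_max[OF mem(2,3)] that unfolding eq[symmetric] m const[OF d] by simp
    have "x [:b, a:] = max (const_norm 0 a * ?\<rho>) (const_norm 0 (b + a * a0))"
    proof (cases "const_norm 0 a * ?\<rho> = const_norm 0 (b + a * a0)")
      case False
      then show ?thesis by (rule ne)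
    next
      case eqT: True
      show ?thesis
      proof (cases "const_norm 0 (b + a * a0) = 0")
        case True
        have "x [:b, a:] \<le> 0" using le by (simp only: eqT True max.idem)
        then show ?thesis using nonneg[OF mem(4)] by (simp only: eqT True max.idem)
      next
        case False
        then have one: "const_norm 0 (b + a * a0) = 1" using const_norm_0[OF d] by (auto split: if_splits)
        \<comment> \<open>The two terms balance at 1, so no \<open>t - a\<close> is smaller than 1; hence \<open>a t + b\<close>, a unit multiple of
          such a polynomial, has value exactly 1.\<close>
        then have Na: "N a = 1" "?\<rho> = 1" using eqT const_norm_0[OF ab(1)] by (auto split: if_splits)
        then have all: "\<And>a. a \<in> R \<Longrightarrow> 1 \<le> x [:- a, 1:]" using min by simp
        have "a \<noteq> 0" using Na by auto
        have q: "b / a \<in> R" using ab Na by (simp add: R_iff N_divide)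
        have "[:b, a:] = [:a:] * [:- (- (b / a)), 1:]" using \<open>a \<noteq> 0\<close> by simp
        then have "x [:b, a:] = x [:a:] * x [:- (- (b / a)), 1:]"
          using mult[of "[:a:]" "[:- (- (b / a)), 1:]"] ab q R_closed(2) by simp
        also have "\<dots> \<ge> 1" using all[of "- (b / a)"] q R_closed(3)[OF q] const[OF ab(1)] Na by simp
        finally have "1 \<le> x [:b, a:]" .
        moreover have "x [:b, a:] \<le> 1" using le by (simp only: eqT one max.idem)
        ultimately show ?thesis by (simp only: eqT one max.idem)
      qed
    qed
    then show "x [:b, a:] = disc_pt a0 0 ?\<rho> [:b, a:]"
      using a0 \<rho> c_pos ab by (simp add: disc_pt_linear max.commute)
  qed
  with a0 that show ?thesis by blast
qed

lemma continuous_map_thicken_centre: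
  assumes a0: "a0 \<in> R" shows "continuous_map X X (\<lambda>y. thicken y (y [:- a0, 1:]))"
proof (rule continuous_map_into_line)
  have l: "[:- a0, 1:] \<in> PR" using a0 R_closed by simp
  show "thicken z (z [:- a0, 1:]) \<in> pts" if "z \<in> topspace X" for z
    using that l by (simp add: thicken_pts pts_nonneg)
  fix a b assume ab: "a \<in> R" "b \<in> R"
  have "continuous_map X euclideanreal (\<lambda>y. max (y [:b, a:]) (y [:a:] * y [:- a0, 1:]))"
    using ab l by (intro continuous_map_real_max continuous_map_real_mult continuous_map_coord) auto
  then show "continuous_map X euclideanreal (\<lambda>y. thicken y (y [:- a0, 1:]) [:b, a:])"
    by (rule continuous_map_eq) (use ab l in \<open>simp add: thicken_linear pts_nonneg\<close>)
qed

lemma continuous_map_disc_radius: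
  assumes a0: "a0 \<in> R" shows "continuous_map X X (\<lambda>y. disc_pt a0 0 (y [:- a0, 1:]))"
proof (rule continuous_map_into_line)
  have l: "[:- a0, 1:] \<in> PR" using a0 R_closed by simp
  show "disc_pt a0 0 (z [:- a0, 1:]) \<in> pts" if "z \<in> topspace X" for z
    using that l a0 c_pos by (simp add: disc_pt_pts pts_nonneg)
  fix a b assume ab: "a \<in> R" "b \<in> R"
  have "continuous_map X euclideanreal (\<lambda>y. max (const_norm 0 (b + a * a0)) (const_norm 0 a * y [:- a0, 1:]))"
    using ab l by (intro continuous_map_real_max continuous_map_real_mult continuous_map_coord) auto
  then show "continuous_map X euclideanreal (\<lambda>y. disc_pt a0 0 (y [:- a0, 1:]) [:b, a:])"
    by (rule continuous_map_eq) (use ab l a0 c_pos in \<open>simp add: disc_pt_linear pts_nonneg\<close>)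
qed

text \<open>The intermediate points of \<open>path_to_residue_disc\<close> depend continuously on \<open>y\<close>, and for \<open>y = x\<close> they
  all equal \<open>x\<close>. So they remain in a given neighbourhood of \<open>x\<close> when \<open>y\<close> is close to \<open>x\<close>.\<close>
lemma small_nbhd_joined_residue:
  assumes x: "x \<in> pts" and c: "x [:c:] = 0" and D: "finite D" "D \<subseteq> R \<times> R" and e: "0 < e"
  shows "\<exists>U. openin X U \<and> x \<in> U \<and> U \<subseteq> nbhd x D e \<and>
    (\<forall>y\<in>U. path_component_of (subtopology X (nbhd x D e)) y x)"
proof -
  let ?B = "nbhd x D e"
  obtain a0 where a0: "a0 \<in> R" and xd: "x = disc_pt a0 0 (x [:- a0, 1:])"
    using residue_point_is_disc[OF x c] by blast
  have l: "[:- a0, 1:] \<in> PR" using a0 R_closed by simp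
  have B: "openin X ?B" by (rule openin_nbhd[OF D])
  have xB: "x \<in> ?B" by (rule nbhd_self[OF x e])
  define U where "U = ?B \<inter> {y \<in> topspace X. thicken y (y [:- a0, 1:]) \<in> ?B}
    \<inter> {y \<in> topspace X. disc_pt a0 0 (y [:- a0, 1:]) \<in> ?B}"
  have "openin X U" unfolding U_def
    by (intro openin_Int B openin_continuous_map_preimage[OF continuous_map_thicken_centre[OF a0]]
        openin_continuous_map_preimage[OF continuous_map_disc_radius[OF a0]])
  moreover have "x \<in> U"
    using xB x xd[symmetric] thicken_eq_disc[OF x a0] by (simp add: U_def c)
  moreover have "path_component_of (subtopology X ?B) y x" if "y \<in> U" for y
    using path_to_residue_disc[OF a0 pts_nonneg[OF x l] D(2), of y x e] that xB xd by (auto simp: U_def)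
  ultimately show ?thesis unfolding U_def by blast
qed

text \<open>First bring \<open>y\<close> into the fibre of \<open>x\<close> by taking the power that sends \<open>y [:c:]\<close> to \<open>x [:c:]\<close>, then
  join it to \<open>x\<close> inside the fibre. The power depends continuously on \<open>y\<close> and leaves \<open>x\<close> fixed.\<close>
lemma small_nbhd_joined_generic:
  assumes x: "x \<in> pts" and c: "0 < x [:c:]" and D: "finite D" "D \<subseteq> R \<times> R" and e: "0 < e"
  shows "\<exists>U. openin X U \<and> x \<in> U \<and> U \<subseteq> nbhd x D e \<and>
    (\<forall>y\<in>U. path_component_of (subtopology X (nbhd x D e)) y x)"
proof -
  let ?B = "nbhd x D e" and ?\<sigma> = "x [:c:]"
  define S where "S = {y \<in> topspace X. y [:c:] \<in> {0<..}}"
  \<comment> \<open>The exponent with \<open>y [:c:] powr k y = x [:c:]\<close>.\<close>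
  define k where "k y = ln ?\<sigma> / ln (y [:c:])" for y :: "'k poly \<Rightarrow> real"
  have cR: "[:c:] \<in> PR" using c_facts by simp
  have S: "openin X S" unfolding S_def
    by (rule openin_continuous_map_preimage[OF continuous_map_coord[OF cR]]) simp
  have B: "openin X ?B" by (rule openin_nbhd[OF D])
  have xB: "x \<in> ?B" by (rule nbhd_self[OF x e])
  have lt1: "0 < y [:c:]" "y [:c:] < 1" "y \<in> pts" if "y \<in> S" for y
    using that pts_c[of y] c_less by (auto simp: S_def)
  have xS: "x \<in> S" using x c by (simp add: S_def)
  have kpos: "0 < k y" if "y \<in> S" for y
    using lt1[OF that] lt1[OF xS] by (simp add: k_def divide_neg_neg)
  have ck: "y [:c:] powr k y = ?\<sigma>" if "y \<in> S" for y
    using lt1[OF that] lt1[OF xS] by (simp add: k_def powr_def)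
  have pts: "power_pt y (k y) \<in> pts" if "y \<in> S" for y
    using lt1[OF that] kpos[OF that] ck[OF that] pts_c[OF x] by (intro power_pt_pts) auto
  have cont: "continuous_map (subtopology X S) X (\<lambda>y. power_pt y (k y))"
  proof (rule continuous_map_into_line)
    show "power_pt z (k z) \<in> pts" if "z \<in> topspace (subtopology X S)" for z
      using that pts by simp
    fix a b assume ab: "a \<in> R" "b \<in> R"
    have co: "continuous_map (subtopology X S) euclideanreal (\<lambda>y. y p)" if "p \<in> PR" for p
      by (intro continuous_map_from_subtopology continuous_map_coord that)
    have "continuous_map (subtopology X S) euclideanreal (\<lambda>y. y [:b, a:] powr k y)"
    proof (rule continuous_map_real_powr)
      show "continuous_map (subtopology X S) euclideanreal k"
        unfolding k_def
      proof (rule continuous_map_real_divide)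
        show "continuous_map (subtopology X S) euclideanreal (\<lambda>y. ln (y [:c:]))"
          by (rule continuous_map_real_ln[OF co[OF cR]]) (simp add: lt1)
        show "ln (y [:c:]) \<noteq> 0" if "y \<in> topspace (subtopology X S)" for y
          using lt1[of y] that by simp
      qed simp
    qed (use ab co kpos in \<open>auto simp: pts_nonneg\<close>)
    then show "continuous_map (subtopology X S) euclideanreal (\<lambda>y. power_pt y (k y) [:b, a:])"
      using ab by (simp add: power_pt_apply)
  qed
  define U where "U = ?B \<inter> {y \<in> topspace (subtopology X S). power_pt y (k y) \<in> ?B}"
  have "openin X U" unfolding U_def
    using openin_continuous_map_preimage[OF cont B] S
    by (intro openin_Int B) (rule openin_trans_full)
  moreover have "x \<in> U"
  proof -
    have "k x = 1" using lt1[OF xS] by (simp add: k_def)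
    then have "power_pt x (k x) = x"
      using pts[OF xS] x by (intro pts_eqI) (auto simp: power_pt_apply pts_nonneg)
    then show ?thesis using xB xS x by (simp add: U_def)
  qed
  moreover have "path_component_of (subtopology X ?B) y x" if "y \<in> U" for y
  proof -
    have y: "y \<in> ?B" "y \<in> S" "power_pt y (k y) \<in> ?B" using that by (auto simp: U_def)
    have "path_component_of (subtopology X ?B) y (power_pt y (k y))"
      using y kpos[OF y(2)] ck[OF y(2)] pts_c[OF x] D(2) by (intro power_path) auto
    moreover have "path_component_of (subtopology X ?B) (power_pt y (k y)) x"
      using y xB ck[OF y(2)] D(2) cR by (intro fibre_path) (auto simp: power_pt_apply)
    ultimately show ?thesis by (rule path_component_of_trans)
  qed
  ultimately show ?thesis unfolding U_def by blast
qed

theorem locally_path_connected_line: "locally_path_connected_space X"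
  unfolding locally_path_connected_space_im_kleinen
proof (intro allI impI)
  fix V x assume V: "openin X V \<and> x \<in> V"
  then have x: "x \<in> pts" using openin_subset by force
  obtain D e where D: "finite D" "D \<subseteq> R \<times> R" "0 < e" "nbhd x D e \<subseteq> V"
    using open_contains_nbhd V by blast
  let ?B = "nbhd x D e"
  obtain U where U: "openin X U" "x \<in> U" "U \<subseteq> ?B" "\<And>y. y \<in> U \<Longrightarrow> path_component_of (subtopology X ?B) y x"
  proof (cases "x [:c:] = 0")
    case True
    then show ?thesis using small_nbhd_joined_residue[OF x _ D(1-3)] that by blast
  next
    case False
    then have "0 < x [:c:]" using pts_c(1)[OF x] by simp
    then show ?thesis using small_nbhd_joined_generic[OF x _ D(1-3)] that by blast
  qed
  have "\<exists>C. path_connectedin X C \<and> C \<subseteq> V \<and> x \<in> C \<and> y \<in> C" if y: "y \<in> U" for y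
  proof -
    let ?C = "Collect (path_component_of (subtopology X ?B) x)"
    have "path_connectedin X ?C \<and> ?C \<subseteq> ?B"
      using path_connectedin_path_component_of[of "subtopology X ?B" x]
      by (simp only: path_connectedin_subtopology)
    moreover have "y \<in> ?C" "x \<in> ?C"
      using U(4)[OF y] path_component_of_sym U(4)[OF U(2)] by auto
    ultimately show ?thesis using D(4) by blast
  qed
  then show "\<exists>U. openin X U \<and> x \<in> U \<and> U \<subseteq> V \<and> (\<forall>y\<in>U. \<exists>C. path_connectedin X C \<and> C \<subseteq> V \<and> x \<in> C \<and> y \<in> C)"
    using U D(4) by (intro exI[of _ U]) auto
qed

section \<open>Countable bases and the residue field\<close>

text \<open>A countable family controlling every linear coordinate suffices, since the finite intersections
  of its members are again countably many.\<close>
lemma countable_base_criterion: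
  assumes x: "x \<in> pts" and count: "countable \<V>" and open_V: "\<And>V. V \<in> \<V> \<Longrightarrow> openin X V \<and> x \<in> V"
    and ctrl: "\<And>a b e. a \<in> R \<Longrightarrow> b \<in> R \<Longrightarrow> 0 < e \<Longrightarrow>
      \<exists>\<D>. finite \<D> \<and> \<D> \<subseteq> \<V> \<and> (\<forall>y \<in> pts \<inter> \<Inter>\<D>. \<bar>y [:b, a:] - x [:b, a:]\<bar> < e)"
  shows "\<exists>\<B>. countable \<B> \<and> (\<forall>V\<in>\<B>. openin X V) \<and> (\<forall>U. openin X U \<and> x \<in> U \<longrightarrow> (\<exists>V\<in>\<B>. x \<in> V \<and> V \<subseteq> U))"
proof (intro exI conjI allI impI ballI)
  let ?\<B> = "(\<lambda>\<D>. topspace X \<inter> \<Inter>\<D>) ` {\<D>. finite \<D> \<and> \<D> \<subseteq> \<V>}"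
  show "countable ?\<B>" by (intro countable_image countable_Collect_finite_subset count)
  show "openin X V" if "V \<in> ?\<B>" for V
  proof -
    from that obtain \<D> where D: "finite \<D>" "\<D> \<subseteq> \<V>" "V = topspace X \<inter> \<Inter>\<D>" by blast
    have "openin X ((\<Inter>V\<in>\<D>. V) \<inter> topspace X)" using D open_V by (intro openin_INT) auto
    then show ?thesis using D by (simp add: Int_commute)
  qed
  fix U assume U: "openin X U \<and> x \<in> U"
  obtain D e where D: "finite D" "D \<subseteq> R \<times> R" "0 < e" "nbhd x D e \<subseteq> U"
    using open_contains_nbhd U by blast
  have "\<forall>p\<in>D. \<exists>\<D>. finite \<D> \<and> \<D> \<subseteq> \<V> \<and> (\<forall>y \<in> pts \<inter> \<Inter>\<D>. \<bar>y [:fst p, snd p:] - x [:fst p, snd p:]\<bar> < e)"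
    using D by (intro ballI ctrl) auto
  from bchoice[OF this] obtain F where F0: "\<forall>p\<in>D. finite (F p) \<and> F p \<subseteq> \<V> \<and>
      (\<forall>y \<in> pts \<inter> \<Inter>(F p). \<bar>y [:fst p, snd p:] - x [:fst p, snd p:]\<bar> < e)" by (rule exE)
  note F = bspec[OF F0]
  let ?W = "topspace X \<inter> \<Inter>(\<Union>(F ` D))"
  have fin: "finite (\<Union>(F ` D))" "\<Union>(F ` D) \<subseteq> \<V>" using F D by auto
  then have "?W \<in> ?\<B>" by blast
  moreover have "x \<in> ?W" using x open_V fin(2) by auto
  moreover have "?W \<subseteq> U"
  proof
    fix y assume y: "y \<in> ?W"
    have "\<bar>y [:b, a:] - x [:b, a:]\<bar> < e" if "(b, a) \<in> D" for b a
    proof -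
      have "y \<in> pts \<inter> \<Inter>(F (b, a))" using y that by auto
      then show ?thesis using F[OF that] by auto
    qed
    then have "y \<in> nbhd x D e" using y by (auto simp: nbhd_def)
    then show "y \<in> U" using D(4) by blast
  qed
  ultimately show "\<exists>V\<in>?\<B>. x \<in> V \<and> V \<subseteq> U" by (intro bexI[of _ ?W] conjI)
qed

lemma maximal_ideal_iff: "a \<in> maximal_ideal R \<longleftrightarrow> N a < 1"
proof
  assume a: "a \<in> maximal_ideal R"
  then have aR: "a \<in> R" and nu: "\<not> (\<exists>b\<in>R. a * b = 1)" by (auto simp: maximal_ideal_def)
  show "N a < 1"
  proof (rule ccontr)
    assume "\<not> N a < 1"
    then have 1: "N a = 1" using aR by (simp add: R_iff)
    then have "a \<noteq> 0" by auto
    then have "a * (1 / a) = 1" "1 / a \<in> R" using 1 by (simp_all add: R_iff N_divide N.one)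
    then show False using nu by blast
  qed
next
  assume a: "N a < 1"
  have "a * b \<noteq> 1" if "b \<in> R" for b
  proof
    assume "a * b = 1"
    then have "N a * N b = 1" using norm_mult[of a b] by (simp add: N.one)
    moreover have "N a * N b \<le> N a" using that by (simp add: R_iff mult_left_le)
    ultimately show False using a by simp
  qed
  then show "a \<in> maximal_ideal R" using a by (auto simp: maximal_ideal_def R_iff)
qed

definition residue_rel :: "('k \<times> 'k) set" where
  "residue_rel = {(a, b). a \<in> R \<and> b \<in> R \<and> a - b \<in> maximal_ideal R}"

lemma residue_rel_iff: "(a, b) \<in> residue_rel \<longleftrightarrow> a \<in> R \<and> b \<in> R \<and> N (a - b) < 1"
  by (simp add: residue_rel_def maximal_ideal_iff)

lemma residue_field_eq: "residue_field R = (\<lambda>a. residue_rel `` {a}) ` R"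
  by (auto simp: residue_field_def residue_rel_def quotient_def)

lemma N_diff_commute: "N (a - b) = N (b - a)"
  using N.uminus[of "a - b"] by simp

lemma residue_class_eq:
  assumes "N (a - b) < 1" "a \<in> R" "b \<in> R" shows "residue_rel `` {a} = residue_rel `` {b}"
proof -
  have "N (b - d) < 1 \<longleftrightarrow> N (a - d) < 1" for d
    using N.ultra[of "a - b" "b - d"] N.ultra[of "b - a" "a - d"] assms N_diff_commute[of a b] by auto
  then show ?thesis using assms by (auto simp: residue_rel_iff)
qed

lemma residue_class_self: "a \<in> R \<Longrightarrow> a \<in> residue_rel `` {a}"
  by (simp add: residue_rel_iff)

lemma countable_representatives:
  assumes "countable (residue_field R)"
  obtains C where "countable C" "C \<subseteq> R" "\<And>a. a \<in> R \<Longrightarrow> \<exists>b\<in>C. N (a - b) < 1"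
proof
  let ?C = "(\<lambda>Q. SOME b. b \<in> Q) ` residue_field R"
  have rep: "(a, SOME b. b \<in> residue_rel `` {a}) \<in> residue_rel" if "a \<in> R" for a
    using someI[of "\<lambda>b. b \<in> residue_rel `` {a}", OF residue_class_self[OF that]] by simp
  show "countable ?C" using assms by simp
  show "?C \<subseteq> R" using rep by (auto simp: residue_field_eq residue_rel_iff)
  show "\<exists>b\<in>?C. N (a - b) < 1" if "a \<in> R" for a
    using rep[OF that] that unfolding residue_field_eq by (auto simp: residue_rel_iff)
qed

text \<open>At the Gauss point of the residue fibre, a neighbourhood misses the classical points of only
  finitely many residue classes: \<open>a t + b\<close> distinguishes the Gauss point from the point \<open>t = a0\<close> only if
  \<open>a0\<close> lies in the class of \<open>- b / a\<close>. On the other hand, for each class some neighbourhood in a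
  given base misses a point of that class. So a countable base bounds the number of classes.\<close>
lemma countable_residue_field:
  assumes fc: "first_countable X" shows "countable (residue_field R)"
proof -
  let ?g = "disc_pt 0 0 1"
  have g: "?g \<in> pts" using c_pos R_closed by (intro disc_pt_pts) auto
  have glin: "?g [:b, a:] = max (const_norm 0 b) (const_norm 0 a)" if "a \<in> R" "b \<in> R" for a b
    using that c_pos R_closed(1) by (simp add: disc_pt_linear)
  have ev: "eval_pt a 0 \<in> pts" if "a \<in> R" for a using that c_pos by (intro eval_pt_pts) auto
  have evlin: "eval_pt a0 0 [:b, a:] = const_norm 0 (b + a0 * a)" if "a \<in> R" "b \<in> R" for a0 a b
    using that by (simp add: eval_pt_def)
  obtain \<B> where B: "countable \<B>" "\<And>V. V \<in> \<B> \<Longrightarrow> openin X V"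
      "\<And>U. openin X U \<Longrightarrow> ?g \<in> U \<Longrightarrow> \<exists>V\<in>\<B>. ?g \<in> V \<and> V \<subseteq> U"
    using fc g unfolding first_countable_def topspace_X by (metis (no_types, lifting))
  define missed where "missed V = {residue_rel `` {a} |a. a \<in> R \<and> eval_pt a 0 \<notin> V}" for V
  have fin: "finite (missed V)" if V: "V \<in> \<B>" "?g \<in> V" for V
  proof -
    obtain D e where D: "finite D" "D \<subseteq> R \<times> R" "0 < e" "nbhd ?g D e \<subseteq> V"
      using open_contains_nbhd[OF B(2)[OF V(1)] V(2)] by blast
    have "missed V \<subseteq> (\<lambda>p. residue_rel `` {- (fst p / snd p)}) ` D"
    proof
      fix Q assume "Q \<in> missed V"
      then obtain a0 where a0: "Q = residue_rel `` {a0}" "a0 \<in> R" "eval_pt a0 0 \<notin> V"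
        by (auto simp: missed_def)
      then have "eval_pt a0 0 \<notin> nbhd ?g D e" using D(4) by blast
      then obtain b a where ba: "(b, a) \<in> D" "\<not> \<bar>eval_pt a0 0 [:b, a:] - ?g [:b, a:]\<bar> < e"
        using ev[OF a0(2)] by (auto simp: nbhd_def)
      then have ab: "a \<in> R" "b \<in> R" using D(2) by auto
      have d: "b + a0 * a \<in> R" using ab a0 by (intro R_closed)
      have "const_norm 0 (b + a0 * a) \<noteq> max (const_norm 0 b) (const_norm 0 a)"
        using ba(2) D(3) by (auto simp: evlin glin ab)
      moreover have le: "N (b + a0 * a) \<le> max (N b) (N a)"
      proof -
        have "N (a0 * a) \<le> N a" using a0(2) by (simp add: norm_mult R_iff mult_left_le_one_le)
        then show ?thesis using N.ultra[of b "a0 * a"] by simp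
      qed
      ultimately have ne: "N (b + a0 * a) < 1" "N b = 1 \<or> N a = 1"
        using ab d by (auto simp: const_norm_0 R_iff split: if_splits)
      have Na: "N a = 1"
      proof (rule ccontr)
        assume "N a \<noteq> 1"
        then have "N b = 1" "N a < 1" using ne ab by (auto simp: R_iff)
        moreover have "N (a0 * a) \<le> N a" using a0(2) by (simp add: norm_mult R_iff mult_left_le_one_le)
        ultimately have "N (b + a0 * a) = N b" by (intro N.dominant) auto
        then show False using ne \<open>N b = 1\<close> by simp
      qed
      then have "a \<noteq> 0" by auto
      have q: "- (b / a) \<in> R" using ab Na by (simp add: R_iff N.uminus N_divide)
      have "a0 - - (b / a) = (b + a0 * a) / a" using \<open>a \<noteq> 0\<close> by (simp add: field_simps)
      then have "N (a0 - - (b / a)) = N (b + a0 * a)" using Na by (simp only: N_divide div_by_1)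
      then have "N (a0 - - (b / a)) < 1" using ne(1) by (simp only:)
      then have "Q = residue_rel `` {- (b / a)}" using a0 q by (simp only: residue_class_eq)
      then show "Q \<in> (\<lambda>p. residue_rel `` {- (fst p / snd p)}) ` D" using ba(1) by force
    qed
    then show ?thesis using D(1) finite_subset by blast
  qed
  have "residue_field R \<subseteq> (\<Union>V \<in> {V \<in> \<B>. ?g \<in> V}. missed V)"
  proof
    fix Q assume "Q \<in> residue_field R"
    then obtain a where a: "a \<in> R" "Q = residue_rel `` {a}" by (auto simp: residue_field_eq)
    have l: "[:- a, 1:] \<in> PR" using a R_closed by simp
    \<comment> \<open>At \<open>t - a\<close> the Gauss point has value 1 and the classical point at \<open>a\<close> has value 0.\<close>
    let ?U = "{y \<in> topspace X. y [:- a, 1:] \<in> {1/2<..}}"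
    have "openin X ?U"
      by (rule openin_continuous_map_preimage[OF continuous_map_coord[OF l]]) simp
    moreover have "?g \<in> ?U"
      using g glin[of 1 "- a"] a R_closed by (simp add: less_max_iff_disj)
    ultimately obtain V where V: "V \<in> \<B>" "?g \<in> V" "V \<subseteq> ?U" using B(3) by blast
    have "eval_pt a 0 [:- a, 1:] = 0" using evlin[of 1 "- a" a] a R_closed by simp
    then have "eval_pt a 0 \<notin> V" using V(3) by auto
    then show "Q \<in> (\<Union>V \<in> {V \<in> \<B>. ?g \<in> V}. missed V)" using V a by (auto simp: missed_def)
  qed
  moreover have "countable (\<Union>V \<in> {V \<in> \<B>. ?g \<in> V}. missed V)"
    using B(1) fin by (intro countable_UN) (auto intro: countable_finite countable_subset[OF _ B(1)])
  ultimately show ?thesis using countable_subset by blast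
qed

text \<open>The values at all elements of the maximal ideal tend to 0 together with the value at \<open>c\<close>.\<close>
lemma small_const:
  assumes d: "d \<in> R" "N d < 1" and e: "0 < e"
  obtains \<delta> where "0 < \<delta>" "\<And>y. y \<in> pts \<Longrightarrow> y [:c:] < \<delta> \<Longrightarrow> y [:d:] < e"
proof -
  have "\<exists>\<delta>>0. \<forall>\<sigma>\<in>{0..}. dist \<sigma> 0 < \<delta> \<longrightarrow> dist (const_norm \<sigma> d) (const_norm 0 d) < e"
    using continuous_on_const_norm[OF d(1)] e unfolding continuous_on_iff by force
  then obtain \<delta> where "0 < \<delta>" "\<And>\<sigma>. 0 \<le> \<sigma> \<Longrightarrow> \<sigma> < \<delta> \<Longrightarrow> const_norm \<sigma> d < e"
    using const_norm_0[OF d(1)] d(2) by (auto simp: dist_real_def const_norm_nonneg)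
  then show ?thesis using that pts_const[OF _ d(1)] pts_c by metis
qed

text \<open>Near a point of the residue fibre, the value at \<open>c\<close> and the values at \<open>t - d\<close>, for \<open>d\<close> in a set of
  representatives of the residue classes, control everything. If \<open>a\<close> is a unit, \<open>a t + b\<close> differs from a
  unit times such a \<open>t - d\<close> by an element of the maximal ideal; if \<open>a\<close> is not a unit, \<open>a t\<close> is small and
  only the constant \<open>b\<close> matters.\<close>
lemma countable_base_residue:
  assumes x: "x \<in> pts" and c: "x [:c:] = 0" and count: "countable (residue_field R)"
  shows "\<exists>\<B>. countable \<B> \<and> (\<forall>V\<in>\<B>. openin X V) \<and> (\<forall>U. openin X U \<and> x \<in> U \<longrightarrow> (\<exists>V\<in>\<B>. x \<in> V \<and> V \<subseteq> U))"
proof -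
  obtain C where C: "countable C" "C \<subseteq> R" "\<And>a. a \<in> R \<Longrightarrow> \<exists>b\<in>C. N (a - b) < 1"
    using countable_representatives[OF count] by blast
  define W where "W p n = {y \<in> pts. \<bar>y p - x p\<bar> < 1 / real (Suc n)}" for p n
  define L where "L = insert [:c:] ((\<lambda>b. [:- b, 1:]) ` C)"
  have L: "L \<subseteq> PR" using C(2) R_closed c_facts by (auto simp: L_def)
  have constx: "x [:d:] = const_norm 0 d" if "d \<in> R" for d
    using pts_const[OF x that] c by simp
  show ?thesis
  proof (rule countable_base_criterion[OF x, of "(\<lambda>(p, n). W p n) ` (L \<times> UNIV)"])
    show "countable ((\<lambda>(p, n). W p n) ` (L \<times> UNIV))"
      using C(1) by (auto simp: L_def)
    show "openin X V \<and> x \<in> V" if "V \<in> (\<lambda>(p, n). W p n) ` (L \<times> UNIV)" for V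
      using that L x by (auto simp: W_def intro!: openin_coord_near)
    fix a b :: 'k and e :: real assume ab: "a \<in> R" "b \<in> R" and e: "0 < e"
    have arch: "\<exists>n. 1 / real (Suc n) < d" if "0 < d" for d
      using reals_Archimedean[OF that] by (simp add: inverse_eq_divide)
    have Wc: "\<exists>n. \<forall>y \<in> W [:c:] n. y [:d:] < e'" if H: "d \<in> R" "N d < 1" "0 < e'" for d e'
    proof -
      obtain \<delta> where \<delta>: "0 < \<delta>" "\<And>y. y \<in> pts \<Longrightarrow> y [:c:] < \<delta> \<Longrightarrow> y [:d:] < e'"
        using small_const[OF H] by blast
      obtain n where "1 / real (Suc n) < \<delta>" using arch[OF \<delta>(1)] by blast
      then have "y [:d:] < e'" if "y \<in> W [:c:] n" for y
        using that \<delta>(2)[of y] c by (auto simp: W_def)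
      then show ?thesis by blast
    qed
    have close: "\<bar>y p - y q\<bar> \<le> y (p - q)" if "y \<in> pts" "p \<in> PR" "q \<in> PR" for y p q
    proof -
      interpret nonarch_seminorm PR y by (rule pts_nonarch[OF that(1)])
      have pq: "p - q \<in> PR" "q - p \<in> PR" using that by (simp_all add: PR_closed)
      have "y p \<le> max (y (p - q)) (y q)" "y q \<le> max (y (q - p)) (y p)"
        using ultra[OF pq(1) that(3)] ultra[OF pq(2) that(2)] by simp_all
      moreover have "y (q - p) = y (p - q)" using uminus[OF pq(1)] by simp
      ultimately show ?thesis using nonneg[OF pq(1)] nonneg[OF that(2)] nonneg[OF that(3)]
        by (auto simp: max_def split: if_splits)
    qed
    show "\<exists>\<D>. finite \<D> \<and> \<D> \<subseteq> (\<lambda>(p, n). W p n) ` (L \<times> UNIV) \<and>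
        (\<forall>y \<in> pts \<inter> \<Inter>\<D>. \<bar>y [:b, a:] - x [:b, a:]\<bar> < e)"
    proof (cases "N a = 1")
      case True
      then have "a \<noteq> 0" by auto
      define s where "s = - (b / a)"
      have s: "s \<in> R" using ab True by (simp add: s_def R_iff N.uminus N_divide)
      obtain t where t: "t \<in> C" "N (s - t) < 1" using C(3)[OF s] by blast
      have tR: "t \<in> R" "s - t \<in> R" using t C(2) s R_closed by auto
      have mem: "[:- s, 1:] \<in> PR" "[:- t, 1:] \<in> PR" using s tR R_closed by auto
      have red: "y [:b, a:] = y [:- s, 1:]" if "y \<in> pts" for y
      proof -
        have "[:b, a:] = [:a:] * [:- s, 1:]" using \<open>a \<noteq> 0\<close> by (simp add: s_def)
        then have "y [:b, a:] = y [:a:] * y [:- s, 1:]"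
          using pts_mult[OF that, of "[:a:]" "[:- s, 1:]"] ab mem by simp
        then show ?thesis using pts_const[OF that ab(1)] True by simp
      qed
      have near: "\<bar>y [:- s, 1:] - y [:- t, 1:]\<bar> \<le> y [:s - t:]" if "y \<in> pts" for y
      proof -
        have "[:- t, 1:] - [:- s, 1:] = [:s - t:]" by simp
        then show ?thesis using close[OF that mem(2,1)] by (simp add: abs_minus_commute)
      qed
      have xs: "x [:- s, 1:] = x [:- t, 1:]"
        using near[OF x] constx[OF tR(2)] t(2) by (simp add: const_norm_0 tR)
      obtain n where n: "\<And>y. y \<in> W [:c:] n \<Longrightarrow> y [:s - t:] < e / 2"
        using Wc[OF tR(2) t(2), of "e / 2"] e by auto
      obtain m where m: "1 / real (Suc m) < e / 2" using arch[of "e / 2"] e by auto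
      show ?thesis
      proof (intro exI conjI ballI)
        show "finite {W [:c:] n, W [:- t, 1:] m}" by simp
        show "{W [:c:] n, W [:- t, 1:] m} \<subseteq> (\<lambda>(p, n). W p n) ` (L \<times> UNIV)"
          using t(1) by (auto simp: L_def)
        fix y assume y: "y \<in> pts \<inter> \<Inter>{W [:c:] n, W [:- t, 1:] m}"
        then have "\<bar>y [:- t, 1:] - x [:- t, 1:]\<bar> < 1 / real (Suc m)" by (simp add: W_def)
        then show "\<bar>y [:b, a:] - x [:b, a:]\<bar> < e"
          using near[of y] n[of y] m y by (simp add: red x xs)
      qed
    next
      case False
      then have Na: "N a < 1" using ab by (simp add: R_iff)
      obtain t where t: "t \<in> C" using C(3)[OF ab(1)] by blast
      have tR: "t \<in> R" using t C(2) by auto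
      have mem: "[:0, 1:] \<in> PR" "[:- t, 1:] \<in> PR" "[:t:] \<in> PR" "[:b:] \<in> PR" "[:b, a:] \<in> PR" "[:a:] \<in> PR"
        using tR ab R_closed by auto
      \<comment> \<open>A bound for \<open>t\<close> near \<open>x\<close>: its distance from the representative is at most \<open>x [:- t, 1:] + 1\<close>, and
        the representative itself has value at most 1.\<close>
      define M where "M = x [:- t, 1:] + 2"
      have M: "0 < M" using pts_nonneg[OF x mem(2)] by (simp add: M_def)
      have near: "\<bar>y [:b, a:] - y [:b:]\<bar> \<le> y [:a:] * y [:0, 1:]" if "y \<in> pts" for y
      proof -
        have "[:b, a:] - [:b:] = [:a:] * [:0, 1:]" by simp
        then show ?thesis using close[OF that mem(5,4)] pts_mult[OF that mem(6,1)] by simp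
      qed
      have xb: "x [:b, a:] = x [:b:]"
        using near[OF x] constx[OF ab(1)] Na by (simp add: const_norm_0 ab)
      have bound: "y [:0, 1:] \<le> M" if "y \<in> W [:- t, 1:] 0" for y
      proof -
        have y: "y \<in> pts" "\<bar>y [:- t, 1:] - x [:- t, 1:]\<bar> < 1" using that by (auto simp: W_def)
        have "[:0, 1:] - [:- t, 1:] = [:t:]" by simp
        then have "\<bar>y [:0, 1:] - y [:- t, 1:]\<bar> \<le> y [:t:]" using close[OF y(1) mem(1,2)] by simp
        moreover have "y [:t:] \<le> 1" using pts_contractive[OF y(1) tR] tR by (simp add: R_iff)
        ultimately show ?thesis using y(2) by (simp add: M_def)
      qed
      obtain n where n: "\<And>y. y \<in> W [:c:] n \<Longrightarrow> y [:a:] < e / (2 * M)"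
        using Wc[OF ab(1) Na, of "e / (2 * M)"] e M by auto
      have "\<exists>m. \<forall>y \<in> W [:c:] m. \<bar>y [:b:] - x [:b:]\<bar> < e / 2"
      proof (cases "N b = 1")
        case True
        then show ?thesis using e x by (auto simp: W_def pts_const[OF _ ab(2)])
      next
        case False
        then have Nb: "N b < 1" using ab by (simp add: R_iff)
        then obtain m where "\<And>y. y \<in> W [:c:] m \<Longrightarrow> y [:b:] < e / 2"
          using Wc[OF ab(2) Nb, of "e / 2"] e by auto
        moreover have "x [:b:] = 0" using constx[OF ab(2)] Nb by (simp add: const_norm_0 ab)
        moreover have "0 \<le> y [:b:]" if "y \<in> W [:c:] m" for y
          using that mem(4) by (auto simp: W_def intro: pts_nonneg)
        ultimately show ?thesis by force
      qed
      then obtain m where m: "\<And>y. y \<in> W [:c:] m \<Longrightarrow> \<bar>y [:b:] - x [:b:]\<bar> < e / 2" by blast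
      show ?thesis
      proof (intro exI conjI ballI)
        show "finite {W [:c:] n, W [:c:] m, W [:- t, 1:] 0}" by simp
        show "{W [:c:] n, W [:c:] m, W [:- t, 1:] 0} \<subseteq> (\<lambda>(p, n). W p n) ` (L \<times> UNIV)"
          using t by (auto simp: L_def)
        fix y assume "y \<in> pts \<inter> \<Inter>{W [:c:] n, W [:c:] m, W [:- t, 1:] 0}"
        then have y: "y \<in> pts" "y \<in> W [:c:] n" "y \<in> W [:c:] m" "y \<in> W [:- t, 1:] 0" by auto
        have "y [:a:] * y [:0, 1:] \<le> e / (2 * M) * M"
          using n[OF y(2)] bound[OF y(4)] e M pts_nonneg[OF y(1)] mem by (intro mult_mono) auto
        also have "\<dots> = e / 2" using M by simp
        finally show "\<bar>y [:b, a:] - x [:b, a:]\<bar> < e"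
          using near[OF y(1)] m[OF y(3)] unfolding xb by linarith
      qed
    qed
  qed
qed

section \<open>Countable bases and the line over the field\<close>

abbreviation "ptsK \<equiv> affine_line_set UNIV N"
abbreviation "XK \<equiv> affine_line UNIV N"

lemma polys_over_UNIV: "polys_over UNIV = UNIV"
  by (simp add: polys_over_def)

lemma ptsK_iff:
  "z \<in> ptsK \<longleftrightarrow> nonarch_seminorm UNIV z \<and> (\<forall>a. z [:a:] \<le> N a)"
  using affine_line_set_nonarch[OF subring_UNIV, of N z] N_of_nat_le by (auto simp: polys_over_UNIV)

lemma topspace_XK: "topspace XK = ptsK"
  by (simp add: affine_line_def polys_over_UNIV)

lemma continuous_map_coord_K: "continuous_map XK euclideanreal (\<lambda>z. z p)"
  unfolding affine_line_def polys_over_UNIV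
  by (intro continuous_map_from_subtopology continuous_map_product_projection) simp

lemma ptsK_const:
  assumes z: "z \<in> ptsK" shows "z [:a:] = N a"
proof (cases "a = 0")
  case True
  then show ?thesis using z by (auto simp: ptsK_iff nonarch_seminorm.zero)
next
  case False
  interpret nonarch_seminorm UNIV z using z by (simp add: ptsK_iff)
  have le: "z [:a:] \<le> N a" "z [:1 / a:] \<le> 1 / N a"
    using z[unfolded ptsK_iff, THEN conjunct2, rule_format, of a]
      z[unfolded ptsK_iff, THEN conjunct2, rule_format, of "1 / a"]
    by (simp_all add: N_divide N.one)
  have "[:a:] * [:1 / a:] = 1" using False by (simp add: one_pCons)
  then have "z [:a:] * z [:1 / a:] = 1" using mult[of "[:a:]" "[:1 / a:]"] one by simp
  moreover have "z [:a:] * z [:1 / a:] \<le> z [:a:] * (1 / N a)"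
    using le(2) nonneg by (intro mult_left_mono) auto
  ultimately have "N a \<le> z [:a:]" using norm_pos[OF False] by (simp add: field_simps)
  then show ?thesis using le by simp
qed

lemma restrict_ptsK:
  assumes z: "z \<in> ptsK" shows "restrict z PR \<in> pts"
proof (rule restrict_pts)
  interpret nonarch_seminorm UNIV z using z by (simp add: ptsK_iff)
  show "nonarch_seminorm PR z"
    by unfold_locales (auto simp: subring_PR zero one nonneg mult ultra)
qed (use z in \<open>auto simp: ptsK_iff\<close>)

lemma continuous_map_restrict: "continuous_map XK X (\<lambda>z. restrict z PR)"
proof (rule continuous_map_into_line)
  fix a b assume "a \<in> R" "b \<in> R"
  then show "continuous_map XK euclideanreal (\<lambda>z. restrict z PR [:b, a:])"
    by (simp add: continuous_map_coord_K)
qed (simp add: topspace_XK restrict_ptsK)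

text \<open>Polynomials over the field enter \<open>R[t]\<close> after clearing denominators.\<close>
definition clears :: "'k \<Rightarrow> 'k poly \<Rightarrow> bool" where
  "clears d p \<longleftrightarrow> d \<in> R \<and> d \<noteq> 0 \<and> smult d p \<in> PR"

lemma clearsD:
  assumes "clears d p" shows "d \<in> R" "d \<noteq> 0" "smult d p \<in> PR"
  using assms by (auto simp: clears_def)

lemma smult_PR: "d \<in> R \<Longrightarrow> p \<in> PR \<Longrightarrow> smult d p \<in> PR"
  by (simp add: polys_over_def R_closed)

lemma pts_smult: "y \<in> pts \<Longrightarrow> d \<in> R \<Longrightarrow> p \<in> PR \<Longrightarrow> y (smult d p) = y [:d:] * y p"
  using pts_mult[of y "[:d:]" p] by simp

lemma clears_scale: "clears d p \<Longrightarrow> e \<in> R \<Longrightarrow> e \<noteq> 0 \<Longrightarrow> clears (e * d) p"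
  using smult_PR[of e "smult d p"] by (auto simp: clears_def intro: R_closed)

lemma clears_mult:
  assumes "clears d p" "clears e q" shows "clears (d * e) (p * q)"
proof -
  have "smult (d * e) (p * q) = smult d p * smult e q" by (simp add: mult.commute)
  also have "\<dots> \<in> PR" using assms by (intro PR_closed clearsD)
  finally show ?thesis using clearsD[OF assms(1)] clearsD[OF assms(2)] by (auto simp: clears_def intro: R_closed)
qed

text \<open>A high power of \<open>c\<close> is a common denominator.\<close>
lemma ex_clears: "\<exists>d. clears d p"
proof -
  obtain j where j: "N c ^ j < 1 / (gauss_norm N 1 p + 1)"
    using real_arch_pow_inv[of "1 / (gauss_norm N 1 p + 1)" "N c"] c_less
      N.gauss_norm_nonneg[of p 1] by (auto simp: polys_over_UNIV)
  have g: "0 \<le> gauss_norm N 1 p" by (rule N.gauss_norm_nonneg) (auto simp: polys_over_UNIV)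
  have "N (c ^ j * coeff p i) \<le> 1" for i
  proof -
    have "N (c ^ j * coeff p i) \<le> N c ^ j * (gauss_norm N 1 p + 1)"
      using N.gauss_norm_ge[of p 1 i]
      by (auto simp: polys_over_UNIV norm_mult N_power intro!: mult_left_mono)
    also have "\<dots> \<le> 1" using j g by (simp add: field_simps)
    finally show ?thesis .
  qed
  then have "smult (c ^ j) p \<in> PR" by (simp add: polys_over_def R_iff)
  then show ?thesis
    using c_facts subring_power[OF subring_R, of c j] by (auto simp: clears_def)
qed

definition denom :: "'k poly \<Rightarrow> 'k" where "denom p = (SOME d. clears d p)"

lemma clears_denom: "clears (denom p) p"
  unfolding denom_def using ex_clears by (rule someI_ex)

lemma clears_PR: "p \<in> PR \<Longrightarrow> clears 1 p"
  by (simp add: clears_def R_closed)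

lemma clears_const: "clears d [:a:] \<longleftrightarrow> d \<in> R \<and> d \<noteq> 0 \<and> d * a \<in> R"
  by (simp add: clears_def)

text \<open>The extension of \<open>y\<close> from \<open>R[t]\<close> to the polynomials over the field.\<close>
definition quot :: "('k poly \<Rightarrow> real) \<Rightarrow> 'k poly \<Rightarrow> real" where
  "quot y p = y (smult (denom p) p) / y [:denom p:]"

text \<open>The exponent undoes the power by which \<open>y\<close> differs from \<open>N\<close> on constants, so \<open>generic\<close> projects the
  part \<open>y [:c:] > 0\<close> of the line over \<open>R\<close> onto the line over the field. Together with \<open>y [:c:]\<close> it
  recovers \<open>y\<close>, by \<open>generic_inverse\<close>.\<close>
definition generic :: "('k poly \<Rightarrow> real) \<Rightarrow> 'k poly \<Rightarrow> real" where
  "generic y p = quot y p powr (ln (N c) / ln (y [:c:]))"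

definition generic_part :: "('k poly \<Rightarrow> real) set" where
  "generic_part = {y \<in> topspace X. y [:c:] \<in> {0<..}}"

lemma c_mem: "[:c:] \<in> PR" using c_facts by simp

lemma openin_generic_part: "openin X generic_part"
  unfolding generic_part_def
  by (rule openin_continuous_map_preimage[OF continuous_map_coord[OF c_mem]]) simp

lemma generic_partD:
  assumes "y \<in> generic_part"
  shows "y \<in> pts" "0 < y [:c:]" "y [:c:] < 1" "ln (y [:c:]) < 0"
  using assms pts_c[of y] c_less by (auto simp: generic_part_def)

lemma const_pos:
  assumes y: "y \<in> generic_part" and d: "d \<in> R" "d \<noteq> 0" shows "0 < y [:d:]"
  using generic_partD[OF y] d by (auto simp: pts_const const_norm_def)

lemma quot_eq:
  assumes y: "y \<in> generic_part" and d: "clears d p"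
  shows "quot y p = y (smult d p) / y [:d:]"
proof -
  let ?d = "denom p"
  have d': "clears ?d p" by (rule clears_denom)
  note yp = generic_partD(1)[OF y]
  have "[:d:] * smult ?d p = [:?d:] * smult d p" by (simp add: mult.commute)
  then have "y ([:d:] * smult ?d p) = y ([:?d:] * smult d p)" by (rule arg_cong)
  then have "y [:d:] * y (smult ?d p) = y [:?d:] * y (smult d p)"
    using d d' by (subst (asm) (1 2) pts_mult[OF yp]) (auto simp: clears_def)
  moreover have "0 < y [:d:]" "0 < y [:?d:]" using d d' y const_pos by (auto simp: clears_def)
  ultimately show ?thesis by (simp add: quot_def field_simps)
qed

lemma quot_PR: "y \<in> generic_part \<Longrightarrow> p \<in> PR \<Longrightarrow> quot y p = y p"
  using quot_eq[OF _ clears_PR, of y p] pts_one[of y] generic_partD(1)[of y] by (simp flip: one_pCons)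

lemma quot_seminorm:
  assumes y: "y \<in> generic_part" shows "nonarch_seminorm UNIV (quot y)"
proof
  note yp = generic_partD(1)[OF y]
  interpret nonarch_seminorm PR y by (rule pts_nonarch[OF yp])
  show "quot y 0 = 0" "quot y 1 = 1"
    using quot_PR[OF y] PR_closed(1,2) by (simp_all add: zero one)
  fix p q
  let ?d = "denom p" and ?e = "denom q"
  note d = clears_denom[of p] and e = clears_denom[of q]
  note dR = clearsD[OF d] and eR = clearsD[OF e]
  have pos: "0 < y [:?d:]" "0 < y [:?e:]" using dR eR const_pos[OF y] by auto
  show "0 \<le> quot y p" using dR pos nonneg by (simp add: quot_def)
  have "y [:?d * ?e:] = y [:?d:] * y [:?e:]"
    using pts_smult[OF yp dR(1), of "[:?e:]"] eR by simp
  moreover have "smult (?d * ?e) (p * q) = smult ?d p * smult ?e q" by (simp add: mult.commute)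
  ultimately show "quot y (p * q) = quot y p * quot y q"
    using quot_eq[OF y clears_mult[OF d e]] mult[OF dR(3) eR(3)] by (simp only: quot_def times_divide_times_eq)
  have cp: "clears (?e * ?d) p" by (rule clears_scale[OF d eR(1,2)])
  have cq: "clears (?e * ?d) q" using clears_scale[OF e dR(1,2)] by (simp only: mult.commute)
  have cpq: "clears (?e * ?d) (p + q)"
    using clearsD[OF cp] clearsD[OF cq] by (simp add: clears_def smult_add_right PR_closed)
  have "y (smult (?e * ?d) (p + q)) \<le> max (y (smult (?e * ?d) p)) (y (smult (?e * ?d) q))"
    using ultra[OF clearsD(3)[OF cp] clearsD(3)[OF cq]] by (simp only: smult_add_right)
  then have "y (smult (?e * ?d) (p + q)) / y [:?e * ?d:] \<le>
      max (y (smult (?e * ?d) p)) (y (smult (?e * ?d) q)) / y [:?e * ?d:]"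
    using const_pos[OF y clearsD(1,2)[OF cp]] by (intro divide_right_mono) auto
  also have "\<dots> = max (quot y p) (quot y q)"
    using const_pos[OF y clearsD(1,2)[OF cp]] quot_eq[OF y cp] quot_eq[OF y cq]
    by (simp add: max_divide_distrib_right)
  finally show "quot y (p + q) \<le> max (quot y p) (quot y q)"
    using quot_eq[OF y cpq] by simp
qed (rule subring_UNIV)

lemma generic_ptsK:
  assumes y: "y \<in> generic_part" shows "generic y \<in> ptsK"
  unfolding ptsK_iff
proof (intro conjI allI)
  let ?k = "ln (N c) / ln (y [:c:])"
  note D = generic_partD[OF y]
  have k: "0 < ?k" using D c_facts by (simp add: divide_neg_neg)
  show "nonarch_seminorm UNIV (generic y)"
    unfolding generic_def by (rule power_seminorm[OF quot_seminorm[OF y] k])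
  have R: "y [:d:] powr ?k = N d" if "d \<in> R" for d
  proof -
    have ck: "y [:c:] powr ?k = N c" using D c_pos by (simp add: powr_def)
    have "const_norm (y [:c:]) d powr ?k = N d"
      using const_norm_powr[OF that less_imp_le[OF D(2)], of ?k] unfolding ck const_norm_Nc by (rule sym)
    then show ?thesis by (simp only: pts_const[OF D(1) that])
  qed
  fix a
  let ?d = "denom [:a:]"
  have d: "?d \<in> R" "?d \<noteq> 0" "?d * a \<in> R" using clears_denom[of "[:a:]"] by (auto simp: clears_const)
  have "generic y [:a:] = (y [:?d * a:] / y [:?d:]) powr ?k" by (simp add: generic_def quot_def)
  also have "\<dots> = N (?d * a) / N ?d"
    using d pts_nonneg[OF D(1)] by (simp add: powr_divide R)
  also have "\<dots> = N a" using d by (simp add: norm_mult)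
  finally show "generic y [:a:] \<le> N a" by simp
qed

lemma generic_inverse:
  assumes y: "y \<in> generic_part" and p: "p \<in> PR"
  shows "generic y p powr (ln (y [:c:]) / ln (N c)) = y p"
  using generic_partD[OF y] pts_nonneg[of y p] p c_facts
  by (simp add: generic_def quot_PR[OF y p] powr_powr)

lemma generic_restrict:
  assumes z: "z \<in> ptsK" shows "restrict z PR \<in> generic_part" "generic (restrict z PR) = z"
proof -
  interpret nonarch_seminorm UNIV z using z by (simp add: ptsK_iff)
  have c: "restrict z PR [:c:] = N c" using c_mem ptsK_const[OF z] by simp
  show g: "restrict z PR \<in> generic_part"
    using c c_pos restrict_ptsK[OF z] by (simp add: generic_part_def)
  show "generic (restrict z PR) = z"
  proof
    fix p
    have d: "denom p \<in> R" "denom p \<noteq> 0" "smult (denom p) p \<in> PR"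
      using clears_denom[of p] by (auto simp: clears_def)
    have "z (smult (denom p) p) = N (denom p) * z p"
      using mult[of "[:denom p:]" p] ptsK_const[OF z] by simp
    then have "quot (restrict z PR) p = z p"
      using d ptsK_const[OF z] by (simp add: quot_def)
    then show "generic (restrict z PR) p = z p"
      using c_facts nonneg unfolding generic_def c by simp
  qed
qed

lemma continuous_map_generic: "continuous_map (subtopology X generic_part) XK generic"
proof -
  have co: "continuous_map (subtopology X generic_part) euclideanreal (\<lambda>y. y p)" if "p \<in> PR" for p
    by (intro continuous_map_from_subtopology continuous_map_coord that)
  have "continuous_map (subtopology X generic_part) euclideanreal (\<lambda>y. generic y p)" for p
    unfolding generic_def
  proof (rule continuous_map_real_powr)
    have d: "denom p \<in> R" "denom p \<noteq> 0" "smult (denom p) p \<in> PR"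
      using clears_denom[of p] by (auto simp: clears_def)
    show "continuous_map (subtopology X generic_part) euclideanreal (\<lambda>y. quot y p)"
      unfolding quot_def
      by (rule continuous_map_real_divide[OF co[OF d(3)] co]) (use d const_pos in \<open>force+\<close>)
    show "continuous_map (subtopology X generic_part) euclideanreal (\<lambda>y. ln (N c) / ln (y [:c:]))"
    proof (rule continuous_map_real_divide)
      show "continuous_map (subtopology X generic_part) euclideanreal (\<lambda>y. ln (y [:c:]))"
        by (rule continuous_map_real_ln[OF co[OF c_mem]]) (simp add: generic_partD)
      show "ln (y [:c:]) \<noteq> 0" if "y \<in> topspace (subtopology X generic_part)" for y
        using generic_partD(4)[of y] that by simp
    qed simp
    show "0 \<le> quot y p" if "y \<in> topspace (subtopology X generic_part)" for y
      using that nonarch_seminorm.nonneg[OF quot_seminorm] by simp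
    show "0 < ln (N c) / ln (y [:c:])" if "y \<in> topspace (subtopology X generic_part)" for y
      using that generic_partD(4)[of y] c_facts by (simp add: divide_neg_neg)
  qed
  then show ?thesis
    unfolding affine_line_def[of UNIV] continuous_map_in_subtopology polys_over_UNIV continuous_map_componentwise_UNIV
    using generic_ptsK by (auto simp: polys_over_UNIV)
qed

text \<open>Restriction of seminorms to \<open>R[t]\<close> embeds the line over the field in the line over \<open>R\<close>: it is
  continuous and \<open>generic\<close> is a continuous left inverse on an open set.\<close>
lemma first_countable_generic_fibre:
  assumes fc: "first_countable X" shows "first_countable XK"
  unfolding first_countable_def topspace_XK
proof
  fix z assume z: "z \<in> ptsK"
  let ?e = "\<lambda>z. restrict z PR"
  obtain \<B> where B: "countable \<B>" "\<And>V. V \<in> \<B> \<Longrightarrow> openin X V"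
      "\<And>U. openin X U \<Longrightarrow> ?e z \<in> U \<Longrightarrow> \<exists>V\<in>\<B>. ?e z \<in> V \<and> V \<subseteq> U"
    using fc restrict_ptsK[OF z] unfolding first_countable_def topspace_X by (metis (no_types, lifting))
  let ?\<C> = "(\<lambda>V. {w \<in> topspace XK. ?e w \<in> V}) ` \<B>"
  have "countable ?\<C>" using B(1) by simp
  moreover have "\<forall>V\<in>?\<C>. openin XK V"
    using openin_continuous_map_preimage[OF continuous_map_restrict B(2)] by blast
  moreover have "\<exists>V\<in>?\<C>. z \<in> V \<and> V \<subseteq> U" if U: "openin XK U \<and> z \<in> U" for U
  proof -
    let ?U = "{y \<in> topspace (subtopology X generic_part). generic y \<in> U}"
    have "openin (subtopology X generic_part) ?U"
      using U by (intro openin_continuous_map_preimage[OF continuous_map_generic]) auto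
    then have "openin X ?U" using openin_generic_part openin_trans_full by blast
    moreover have "?e z \<in> ?U"
      using generic_restrict[OF z] restrict_ptsK[OF z] U by simp
    ultimately obtain V where V: "V \<in> \<B>" "?e z \<in> V" "V \<subseteq> ?U" using B(3) by blast
    have "{w \<in> topspace XK. ?e w \<in> V} \<subseteq> U"
    proof
      fix w assume "w \<in> {w \<in> topspace XK. ?e w \<in> V}"
      then have w: "w \<in> ptsK" "?e w \<in> ?U" using V(3) by (auto simp: topspace_XK)
      then show "w \<in> U" using generic_restrict(2)[OF w(1)] by simp
    qed
    then show ?thesis using V(1,2) z by (auto simp: topspace_XK)
  qed
  ultimately show "\<exists>\<B>. countable \<B> \<and> (\<forall>V\<in>\<B>. openin XK V) \<and>
      (\<forall>U. openin XK U \<and> z \<in> U \<longrightarrow> (\<exists>V\<in>\<B>. z \<in> V \<and> V \<subseteq> U))" by (intro exI[of _ ?\<C>]) simp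
qed

lemma powr_jointly_continuous:
  assumes "0 \<le> v0" "0 < \<sigma>0" "\<sigma>0 < 1" "0 < e"
  shows "\<exists>\<delta>>0. \<forall>v \<sigma>. 0 \<le> v \<longrightarrow> 0 < \<sigma> \<longrightarrow> \<sigma> < 1 \<longrightarrow> \<bar>v - v0\<bar> < \<delta> \<longrightarrow> \<bar>\<sigma> - \<sigma>0\<bar> < \<delta> \<longrightarrow>
    \<bar>v powr (ln \<sigma> / ln (N c)) - v0 powr (ln \<sigma>0 / ln (N c))\<bar> < e"
proof -
  let ?S = "{0..} \<times> {0<..<1::real}" and ?h = "\<lambda>z. fst z powr (ln (snd z) / ln (N c))"
  have "continuous_on ?S ?h"
    using c_facts by (intro continuous_on_powr' continuous_intros) (auto simp: divide_neg_neg)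
  moreover have "(v0, \<sigma>0) \<in> ?S" using assms by auto
  ultimately obtain d where d: "0 < d" "\<And>z. z \<in> ?S \<Longrightarrow> dist z (v0, \<sigma>0) < d \<Longrightarrow> dist (?h z) (?h (v0, \<sigma>0)) < e"
    using assms(4) unfolding continuous_on_iff by blast
  show ?thesis
  proof (intro exI[of _ "d / 2"] conjI allI impI)
    fix v \<sigma> :: real assume H: "0 \<le> v" "0 < \<sigma>" "\<sigma> < 1" "\<bar>v - v0\<bar> < d / 2" "\<bar>\<sigma> - \<sigma>0\<bar> < d / 2"
    have "dist (v, \<sigma>) (v0, \<sigma>0) \<le> \<bar>v - v0\<bar> + \<bar>\<sigma> - \<sigma>0\<bar>"
      using sqrt_sum_squares_le_sum_abs[of "v - v0" "\<sigma> - \<sigma>0"] by (simp add: dist_prod_def dist_real_def)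
    then have "dist (v, \<sigma>) (v0, \<sigma>0) < d" using H by linarith
    then show "\<bar>v powr (ln \<sigma> / ln (N c)) - v0 powr (ln \<sigma>0 / ln (N c))\<bar> < e"
      using d(2)[of "(v, \<sigma>)"] H by (simp add: dist_real_def)
  qed (use d in simp)
qed

text \<open>The part \<open>y [:c:] > 0\<close> has the two continuous coordinates \<open>generic y\<close> and \<open>y [:c:]\<close>, from which \<open>y\<close> is
  recovered continuously by taking powers. So a countable base at \<open>generic x\<close> and intervals around
  \<open>x [:c:]\<close> suffice.\<close>
lemma countable_base_generic:
  assumes x: "x \<in> pts" and c: "0 < x [:c:]" and fc: "first_countable XK"
  shows "\<exists>\<B>. countable \<B> \<and> (\<forall>V\<in>\<B>. openin X V) \<and> (\<forall>U. openin X U \<and> x \<in> U \<longrightarrow> (\<exists>V\<in>\<B>. x \<in> V \<and> V \<subseteq> U))"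
proof -
  have xg: "x \<in> generic_part" using x c by (simp add: generic_part_def)
  let ?z = "generic x"
  have z: "?z \<in> ptsK" by (rule generic_ptsK[OF xg])
  obtain \<W> where W: "countable \<W>" "\<And>V. V \<in> \<W> \<Longrightarrow> openin XK V"
      "\<And>U. openin XK U \<Longrightarrow> ?z \<in> U \<Longrightarrow> \<exists>V\<in>\<W>. ?z \<in> V \<and> V \<subseteq> U"
    using fc z unfolding first_countable_def topspace_XK by (metis (no_types, lifting))
  define pull where "pull V = {y \<in> topspace (subtopology X generic_part). generic y \<in> V}" for V
  define near where "near n = {y \<in> pts. \<bar>y [:c:] - x [:c:]\<bar> < 1 / real (Suc n)}" for n
  show ?thesis
  proof (rule countable_base_criterion[OF x, of "pull ` {V \<in> \<W>. ?z \<in> V} \<union> range near"])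
    show "countable (pull ` {V \<in> \<W>. ?z \<in> V} \<union> range near)"
      using W(1) by (auto intro: countable_subset[OF _ W(1)])
    show "openin X V \<and> x \<in> V" if V: "V \<in> pull ` {V \<in> \<W>. ?z \<in> V} \<union> range near" for V
    proof -
      consider V' where "V = pull V'" "V' \<in> \<W>" "?z \<in> V'" | n where "V = near n" using V by blast
      then show ?thesis
      proof cases
        case 1
        have "openin (subtopology X generic_part) (pull V')"
          unfolding pull_def by (rule openin_continuous_map_preimage[OF continuous_map_generic W(2)[OF 1(2)]])
        then show ?thesis
          using 1 openin_trans_full[OF _ openin_generic_part] xg x by (auto simp: pull_def)
      next
        case 2
        then show ?thesis using x c_mem by (auto simp: near_def intro!: openin_coord_near)
      qed
    qed
    fix a b :: 'k and e :: real assume ab: "a \<in> R" "b \<in> R" and e: "0 < e"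
    let ?l = "[:b, a:]"
    have l: "?l \<in> PR" using ab by simp
    have nn: "0 \<le> w ?l" if "w \<in> ptsK" for w
      using that nonarch_seminorm.nonneg by (auto simp: ptsK_iff)
    obtain \<delta> where \<delta>: "0 < \<delta>" "\<And>v \<sigma>. 0 \<le> v \<Longrightarrow> 0 < \<sigma> \<Longrightarrow> \<sigma> < 1 \<Longrightarrow> \<bar>v - ?z ?l\<bar> < \<delta> \<Longrightarrow> \<bar>\<sigma> - x [:c:]\<bar> < \<delta> \<Longrightarrow>
        \<bar>v powr (ln \<sigma> / ln (N c)) - ?z ?l powr (ln (x [:c:]) / ln (N c))\<bar> < e"
      using powr_jointly_continuous[OF nn[OF z] generic_partD(2,3)[OF xg] e] by blast
    let ?U = "{w \<in> topspace XK. w ?l \<in> {?z ?l - \<delta> <..< ?z ?l + \<delta>}}"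
    have "openin XK ?U"
      by (rule openin_continuous_map_preimage[OF continuous_map_coord_K]) simp
    moreover have "?z \<in> ?U" using z \<delta>(1) by (simp add: topspace_XK)
    ultimately obtain V where V: "V \<in> \<W>" "?z \<in> V" "V \<subseteq> ?U" using W(3) by blast
    obtain n where n: "1 / real (Suc n) < \<delta>"
      using reals_Archimedean[OF \<delta>(1)] by (auto simp: inverse_eq_divide)
    show "\<exists>\<D>. finite \<D> \<and> \<D> \<subseteq> pull ` {V \<in> \<W>. ?z \<in> V} \<union> range near \<and>
        (\<forall>y \<in> pts \<inter> \<Inter>\<D>. \<bar>y ?l - x ?l\<bar> < e)"
    proof (intro exI conjI ballI)
      show "finite {pull V, near n}" by simp
      show "{pull V, near n} \<subseteq> pull ` {V \<in> \<W>. ?z \<in> V} \<union> range near" using V by blast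
      fix y assume "y \<in> pts \<inter> \<Inter>{pull V, near n}"
      then have y: "y \<in> generic_part" "generic y \<in> V" "\<bar>y [:c:] - x [:c:]\<bar> < 1 / real (Suc n)"
        by (auto simp: pull_def near_def)
      have "generic y \<in> ?U" using y(2) V(3) by blast
      then have "\<bar>generic y ?l - ?z ?l\<bar> < \<delta>" by (auto simp: abs_less_iff)
      then have "\<bar>generic y ?l powr (ln (y [:c:]) / ln (N c)) - ?z ?l powr (ln (x [:c:]) / ln (N c))\<bar> < e"
        using y(3) n generic_partD[OF y(1)] nn[OF generic_ptsK[OF y(1)]] by (intro \<delta>(2)) auto
      then show "\<bar>y ?l - x ?l\<bar> < e"
        by (simp add: generic_inverse[OF y(1) l] generic_inverse[OF xg l])
    qed
  qed
qed

theorem first_countable_line_iff: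
  "first_countable X \<longleftrightarrow> countable (residue_field R) \<and> first_countable XK"
proof (intro iffI conjI)
  assume *: "countable (residue_field R) \<and> first_countable XK"
  show "first_countable X"
    unfolding first_countable_def topspace_X
  proof
    fix x assume x: "x \<in> pts"
    show "\<exists>\<B>. countable \<B> \<and> (\<forall>V\<in>\<B>. openin X V) \<and> (\<forall>U. openin X U \<and> x \<in> U \<longrightarrow> (\<exists>V\<in>\<B>. x \<in> V \<and> V \<subseteq> U))"
    proof (cases "x [:c:] = 0")
      case True
      then show ?thesis using countable_base_residue[OF x] * by blast
    next
      case False
      then have "0 < x [:c:]" using pts_c(1)[OF x] by simp
      then show ?thesis using countable_base_generic[OF x] * by blast
    qed
  qed
qed (auto intro: countable_residue_field first_countable_generic_fibre)

end

section \<open>Complete valuation rings other than fields\<close>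

text \<open>A non-zero element of \<open>R\<close> without inverse in \<open>R\<close> serves as \<open>c\<close>.\<close>
theorem theorem2p8:
  fixes R :: "'k::alg_closed_field set" and N :: "'k \<Rightarrow> real"
  assumes "complete_valuation_ring R N"
    and "\<not> is_subfield R"
  shows "path_connected_space (affine_line R N) \<and>
         locally_path_connected_space (affine_line R N) \<and>
         (first_countable (affine_line R N) \<longleftrightarrow>
            countable (residue_field R) \<and> first_countable (affine_line UNIV N))"
proof -
  interpret complete_valuation_ring R N by fact
  obtain c where c: "c \<in> R" "c \<noteq> 0" "\<And>b. b \<in> R \<Longrightarrow> c * b \<noteq> 1"
    using assms(2) valuation_ring by (auto simp: is_subfield_def valuation_ring_def)
  have "N c \<noteq> 1"
  proof
    assume "N c = 1"
    then have "N (inverse c) = 1"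
      using norm_mult[of c "inverse c"] nonarch_norm_1[OF nonarch] c(2) by simp
    then show False using c(2) c(3)[of "inverse c"] by (simp flip: norm_le_1_iff)
  qed
  then interpret valued_line R N c
    using c norm_pos[of c] by unfold_locales (auto simp: less_le simp flip: norm_le_1_iff)
  show ?thesis
    using path_connected_line locally_path_connected_line first_countable_line_iff by simp
qed

end
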